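(* Let $\Gamma$ be a finite abelian group. Then $$\mathrm{expari}(\mathrm{ARI}(\Gamma)_{\mathrm{al}})=\mathrm{GARI}(\Gamma)_{\mathrm{as}}.$$
   Context: Moulds. $\Gamma$ is a finite abelian group, written multiplicatively. A mould is a sequence $M=(M(u_1,\dots,u_m))_{m\ge 0}$ with $M(\emptyset)\in\mathbb{Q}$ and, for $m\ge1$, a family of rational functions $M\binom{u_1,\dots,u_m}{\sigma_1,\dots,\sigma_m}=M_{\sigma_1,\dots,\sigma_m}(u_1,\dots,u_m)\in\mathbb{Q}(u_1,\dots,u_m)$ indexed by $(\sigma_1,\dots,\sigma_m)\in\Gamma^{m}$. $\mathrm{BIMU}(\Gamma)$ denotes the set of all moulds; it is a $\mathbb{Q}$-vector space componentwise and a unital associative algebra with product $(A\times B)(\mathbf u_m)=\sum_{\mathbf u_m=\alpha\beta}A(\alpha)B(\beta)$ (sum over deconcatenations, including empty factors), where $\mathbf u_m=\binom{u_1,\dots,u_m}{\sigma_1,\dots,\sigma_m}$ is viewed as a word of $m$ letters $\binom{u_i}{\sigma_i}$; unit $I=(1,0,0,\dots)$. $\mathrm{ARI}(\Gamma)$ (resp. $\mathrm{GARI}(\Gamma)$) is the set of $M$ with $M(\emptyset)=0$ (resp. $=1$). In general, letters are $\binom{u}{\sigma}$ with $u$ a $\mathbb{Z}$-linear combination of the $u_i$, and moulds are evaluated at words by substitution. Symmetry types. The shuffle product $\sqcup\!\sqcup$ on the $\mathbb{Q}$-span of words is bilinear with unit $\emptyset$ and $a\omega\sqcup\!\sqcup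 b\eta=a(\omega\sqcup\!\sqcup b\eta)+b(a\omega\sqcup\!\sqcup\eta)$ for letters $a,b$; $\mathrm{Sh}\binom{\omega;\eta}{\alpha}$ is the coefficient of $\alpha$ in $\omega\sqcup\!\sqcup\eta$. $M\in\mathrm{ARI}(\Gamma)$ (resp. $M\in\mathrm{GARI}(\Gamma)$) is alternal (resp. symmetral) if for all $p,q\ge1$ and all $\sigma_i$, with $\omega=\binom{u_1,\dots,u_p}{\sigma_1,\dots,\sigma_p}$, $\eta=\binom{u_{p+1},\dots,u_{p+q}}{\sigma_{p+1},\dots,\sigma_{p+q}}$, $\sum_\alpha\mathrm{Sh}\binom{\omega;\eta}{\alpha}M(\alpha)=0$ (resp. $=M(\omega)M(\eta)$). $\mathrm{ARI}(\Gamma)_{\mathrm{al}}$, $\mathrm{GARI}(\Gamma)_{\mathrm{as}}$ denote the sets of alternal, resp. symmetral, moulds. The derivation $\mathrm{arit}$. For nonempty words $\alpha=\binom{a_1,\dots,a_k}{\sigma_1,\dots,\sigma_k}$, $\beta=\binom{b_1,\dots,b_l}{\tau_1,\dots,\tau_l}$ put ${}_\beta\lceil\alpha=\binom{b_1+\cdots+b_l+a_1,\,a_2,\dots,a_k}{\sigma_1,\sigma_2,\dots,\sigma_k}$, $\alpha\rceil_\beta=\binom{a_1,\dots,a_{k-1},\,a_k+b_1+\cdots+b_l}{\sigma_1,\dots,\sigma_{k-1},\sigma_k}$, ${}_\beta\lfloor\alpha=\binom{a_1,\dots,a_k}{\sigma_1\tau_l^{-1},\dots,\sigma_k\tau_l^{-1}}$,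 $\alpha\rfloor_\beta=\binom{a_1,\dots,a_k}{\sigma_1\tau_1^{-1},\dots,\sigma_k\tau_1^{-1}}$. For moulds $A,B$, $(\mathrm{arit}(B)(A))(\mathbf u_m)=0$ for $m=0,1$ and, for $m\ge2$, $$(\mathrm{arit}(B)(A))(\mathbf u_m)=\sum_{\substack{\mathbf u_m=\alpha\beta\gamma\\ \beta,\gamma\ne\emptyset}}A(\alpha\,{}_\beta\lceil\gamma)\,B(\beta\rfloor_\gamma)-\sum_{\substack{\mathbf u_m=\alpha\beta\gamma\\ \alpha,\beta\ne\emptyset}}A(\alpha\rceil_\beta\,\gamma)\,B({}_\alpha\lfloor\beta).$$ $\mathrm{arit}(B)$ is a derivation of $(\mathrm{BIMU}(\Gamma),\times)$. The map $\mathrm{expari}$. $\mathrm{preari}(A,B)=\mathrm{arit}(B)(A)+A\times B$; $\mathrm{preari}_0(M)=I$, $\mathrm{preari}_k(M)=\mathrm{preari}(\mathrm{preari}_{k-1}(M),M)$ for $k\ge1$; and $\mathrm{expari}:\mathrm{ARI}(\Gamma)\to\mathrm{GARI}(\Gamma)$, $\mathrm{expari}(M)=\sum_{k\ge0}\frac1{k!}\mathrm{preari}_k(M)$ (a finite sum in each depth $m$). *)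

theory Defs
  imports
    Complex_Main
    "HOL-Library.Poly_Mapping"
    "HOL-Library.Multiset"
    "HOL-Library.Groups_Big_Fun"
    "HOL-Computational_Algebra.Fraction_Field"
begin

section \<open>Rational functions and substitution\<close>

text \<open>
  Polynomials over the rationals in countably many variables \<open>u\<^sub>1, u\<^sub>2, \<dots>\<close>, as finitely supported
  functions from exponent vectors to coefficients, and their field of fractions. All variable
  indices are shifted by one: \<open>pvar i\<close> is \<open>u\<^sub>i\<^sub>+\<^sub>1\<close>.
\<close>

type_synonym mpoly = "(nat \<Rightarrow>\<^sub>0 nat) \<Rightarrow>\<^sub>0 rat"
type_synonym ratfun = "mpoly fract"

definition pconst :: "rat \<Rightarrow> mpoly" where
  "pconst c = Poly_Mapping.single 0 c"

definition pvar :: "nat \<Rightarrow> mpoly" where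
  "pvar i = Poly_Mapping.single (Poly_Mapping.single i 1) 1"

definition indets :: "mpoly \<Rightarrow> nat set" where
  "indets p = (\<Union>t\<in>Poly_Mapping.keys p. Poly_Mapping.keys t)"

text \<open>The subfield \<open>\<rat>(u\<^sub>1, \<dots>, u\<^sub>m)\<close>; for \<open>m = 0\<close> it is \<open>\<rat>\<close>.\<close>

definition ratfuns :: "nat \<Rightarrow> ratfun set" where
  "ratfuns m = {Fraction_Field.Fract p q | p q.
     q \<noteq> 0 \<and> indets p \<subseteq> {..<m} \<and> indets q \<subseteq> {..<m}}"

definition psubst :: "(nat \<Rightarrow> mpoly) \<Rightarrow> mpoly \<Rightarrow> mpoly" where
  "psubst s p = (\<Sum>t\<in>Poly_Mapping.keys p.
     pconst (Poly_Mapping.lookup p t) *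
       (\<Prod>i\<in>Poly_Mapping.keys t. s i ^ Poly_Mapping.lookup t i))"

text \<open>
  Substitution is partial: \<open>rsubst s f\<close> is meaningful iff \<open>f\<close> has a representation \<open>p / q\<close> whose
  denominator survives the substitution, and then it does not depend on the representation
  (lemma \<open>rsubst_Fract\<close> below). If the entries of \<open>s\<close> at the variables of \<open>f\<close> are linearly
  independent linear forms, as is the case for all words occurring below, every representation
  of \<open>f\<close> in these variables qualifies.
\<close>

definition rsubst :: "(nat \<Rightarrow> mpoly) \<Rightarrow> ratfun \<Rightarrow> ratfun" where
  "rsubst s f = (THE g. \<exists>p q. psubst s q \<noteq> 0 \<and> f = Fraction_Field.Fract p q \<and>
     g = Fraction_Field.Fract (psubst s p) (psubst s q))"

lemma psubst_superset:
  assumes "finite A" "Poly_Mapping.keys p \<subseteq> A"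
  shows "psubst s p = (\<Sum>t\<in>A. pconst (Poly_Mapping.lookup p t) *
           (\<Prod>i\<in>Poly_Mapping.keys t. s i ^ Poly_Mapping.lookup t i))"
  unfolding psubst_def using assms
  by (intro sum.mono_neutral_left) (auto simp: pconst_def in_keys_iff)

lemma psubst_add: "psubst s (p + q) = psubst s p + psubst s q"
proof -
  let ?A = "Poly_Mapping.keys p \<union> Poly_Mapping.keys q"
  have "Poly_Mapping.keys (p + q) \<subseteq> ?A" by (rule Poly_Mapping.keys_add)
  then show ?thesis
    by (simp add: psubst_superset[of ?A] lookup_add pconst_def single_add
        distrib_right sum.distrib)
qed

lemma psubst_0 [simp]: "psubst s 0 = 0"
  by (simp add: psubst_def)

lemma psubst_sum: "psubst s (\<Sum>x\<in>A. f x) = (\<Sum>x\<in>A. psubst s (f x))"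
  by (induction A rule: infinite_finite_induct) (auto simp: psubst_add)

lemma psubst_single:
  "psubst s (Poly_Mapping.single t c) =
     pconst c * (\<Prod>i\<in>Poly_Mapping.keys t. s i ^ Poly_Mapping.lookup t i)"
  by (simp add: psubst_superset[of "{t}"])

lemma mpoly_as_sum:
  "(p :: mpoly) = (\<Sum>t\<in>Poly_Mapping.keys p. Poly_Mapping.single t (Poly_Mapping.lookup p t))"
  by (rule poly_mapping_eqI) (simp add: lookup_sum lookup_single when_def in_keys_iff sum.delta)

lemma prod_pow_superset:
  assumes "finite A" "Poly_Mapping.keys t \<subseteq> A"
  shows "(\<Prod>i\<in>Poly_Mapping.keys t. s i ^ Poly_Mapping.lookup t i) =
         (\<Prod>i\<in>A. (s i :: mpoly) ^ Poly_Mapping.lookup t i)"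
  using assms by (intro prod.mono_neutral_left) (auto simp: in_keys_iff)

lemma psubst_single_mult:
  "psubst s (Poly_Mapping.single t c * Poly_Mapping.single t' c') =
     psubst s (Poly_Mapping.single t c) * psubst s (Poly_Mapping.single t' c')"
proof -
  define A where "A = Poly_Mapping.keys t \<union> Poly_Mapping.keys t'"
  have A: "finite A" "Poly_Mapping.keys t \<subseteq> A" "Poly_Mapping.keys t' \<subseteq> A"
    "Poly_Mapping.keys (t + t') \<subseteq> A"
    using Poly_Mapping.keys_add[of t t'] by (auto simp: A_def)
  have c: "pconst (c * c') = pconst c * pconst c'"
    by (simp add: pconst_def mult_single)
  show ?thesis
    unfolding mult_single psubst_single c prod_pow_superset[OF A(1,2)]
      prod_pow_superset[OF A(1,3)] prod_pow_superset[OF A(1,4)]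
    by (simp add: lookup_add power_add prod.distrib ac_simps)
qed

lemma psubst_mult: "psubst s (p * q) = psubst s p * psubst s q"
proof -
  let ?m = "\<lambda>p t. Poly_Mapping.single t (Poly_Mapping.lookup p t) :: mpoly"
  have "psubst s (p * q) = psubst s ((\<Sum>t\<in>Poly_Mapping.keys p. ?m p t) * (\<Sum>t\<in>Poly_Mapping.keys q. ?m q t))"
    using mpoly_as_sum[of p] mpoly_as_sum[of q] by simp
  also have "\<dots> = psubst s (\<Sum>t\<in>Poly_Mapping.keys p. ?m p t) * psubst s (\<Sum>t\<in>Poly_Mapping.keys q. ?m q t)"
    by (simp add: sum_product psubst_sum psubst_single_mult)
  finally show ?thesis
    using mpoly_as_sum[of p] mpoly_as_sum[of q] by simp
qed

lemma rsubst_Fract: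
  assumes "psubst s q \<noteq> 0"
  shows "rsubst s (Fraction_Field.Fract p q) = Fraction_Field.Fract (psubst s p) (psubst s q)"
  unfolding rsubst_def
proof (rule the_equality)
  fix g
  assume "\<exists>p' q'. psubst s q' \<noteq> 0 \<and> Fraction_Field.Fract p q = Fraction_Field.Fract p' q' \<and>
    g = Fraction_Field.Fract (psubst s p') (psubst s q')"
  then obtain p' q' where *: "psubst s q' \<noteq> 0"
    "Fraction_Field.Fract p q = Fraction_Field.Fract p' q'"
    "g = Fraction_Field.Fract (psubst s p') (psubst s q')" by blast
  have "q \<noteq> 0" "q' \<noteq> 0" using assms *(1) by auto
  then have "p * q' = p' * q" using *(2) by (simp add: eq_fract)
  then have "psubst s p * psubst s q' = psubst s p' * psubst s q"
    by (metis psubst_mult)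
  then show "g = Fraction_Field.Fract (psubst s p) (psubst s q)"
    using *(1,3) assms by (simp add: eq_fract)
qed (use assms in blast)


section \<open>Moulds\<close>

text \<open>
  The finite abelian group \<open>\<Gamma>\<close> is a type of class \<open>finite\<close> and \<open>ab_group_add\<close>, hence written
  additively: \<open>\<sigma> \<tau>\<^sup>-\<^sup>1\<close> reads \<open>\<sigma> - \<tau>\<close>. A mould maps \<open>[\<sigma>\<^sub>1, \<dots>, \<sigma>\<^sub>m]\<close> to the rational function
  \<open>M\<^bsub>\<sigma>\<^sub>1,\<dots>,\<sigma>\<^sub>m\<^esub>(u\<^sub>1, \<dots>, u\<^sub>m)\<close>. The upper entry of a letter is a polynomial; only integral linear
  forms in the variables ever occur.
\<close>

type_synonym 'g word = "(mpoly \<times> 'g) list"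
type_synonym 'g mould = "'g list \<Rightarrow> ratfun"

definition BIMU :: "'g mould set" where
  "BIMU = {M. \<forall>\<sigma>s. M \<sigma>s \<in> ratfuns (length \<sigma>s)}"

definition ARI :: "'g mould set" where
  "ARI = {M \<in> BIMU. M [] = 0}"

definition GARI :: "'g mould set" where
  "GARI = {M \<in> BIMU. M [] = 1}"

text \<open>Evaluation of a mould at an arbitrary word, by substitution of its upper entries.\<close>

definition at_word :: "'g mould \<Rightarrow> 'g word \<Rightarrow> ratfun" where
  "at_word M w = rsubst (\<lambda>i. if i < length w then fst (w ! i) else 0) (M (map snd w))"

text \<open>The word with upper entries \<open>u\<^sub>n\<^sub>+\<^sub>1, u\<^sub>n\<^sub>+\<^sub>2, \<dots>\<close> and lower entries \<open>\<sigma>s\<close>.\<close>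

definition uword :: "nat \<Rightarrow> 'g list \<Rightarrow> 'g word" where
  "uword n \<sigma>s = zip (map pvar [n..<n + length \<sigma>s]) \<sigma>s"

definition mould_one :: "'g mould" where
  "mould_one \<sigma>s = (if \<sigma>s = [] then 1 else 0)"

definition mould_mult :: "'g mould \<Rightarrow> 'g mould \<Rightarrow> 'g mould" where
  "mould_mult A B \<sigma>s =
     (\<Sum>(\<alpha>, \<beta>) \<in> {(\<alpha>, \<beta>). uword 0 \<sigma>s = \<alpha> @ \<beta>}. at_word A \<alpha> * at_word B \<beta>)"


section \<open>Symmetry types\<close>

text \<open>The shuffle product of two words, as the multiset of its terms.\<close>

fun shuffle :: "'a list \<Rightarrow> 'a list \<Rightarrow> 'a list multiset" where
  "shuffle [] \<eta> = {#\<eta>#}"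
| "shuffle \<omega> [] = {#\<omega>#}"
| "shuffle (a # \<omega>) (b # \<eta>) =
     image_mset ((#) a) (shuffle \<omega> (b # \<eta>)) + image_mset ((#) b) (shuffle (a # \<omega>) \<eta>)"

definition Sh :: "'a list \<Rightarrow> 'a list \<Rightarrow> 'a list \<Rightarrow> nat" where
  "Sh \<omega> \<eta> \<alpha> = count (shuffle \<omega> \<eta>) \<alpha>"

definition shuffle_sum :: "'g mould \<Rightarrow> 'g word \<Rightarrow> 'g word \<Rightarrow> ratfun" where
  "shuffle_sum M \<omega> \<eta> = (\<Sum>\<alpha> \<in> set_mset (shuffle \<omega> \<eta>). of_nat (Sh \<omega> \<eta> \<alpha>) * at_word M \<alpha>)"

definition ARI_al :: "'g mould set" where
  "ARI_al = {M \<in> ARI. \<forall>\<sigma>s \<tau>s. \<sigma>s \<noteq> [] \<longrightarrow> \<tau>s \<noteq> [] \<longrightarrow>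
     shuffle_sum M (uword 0 \<sigma>s) (uword (length \<sigma>s) \<tau>s) = 0}"

definition GARI_as :: "'g mould set" where
  "GARI_as = {M \<in> GARI. \<forall>\<sigma>s \<tau>s. \<sigma>s \<noteq> [] \<longrightarrow> \<tau>s \<noteq> [] \<longrightarrow>
     shuffle_sum M (uword 0 \<sigma>s) (uword (length \<sigma>s) \<tau>s) =
       at_word M (uword 0 \<sigma>s) * at_word M (uword (length \<sigma>s) \<tau>s)}"


section \<open>Flexions, \<open>arit\<close> and \<open>expari\<close>\<close>

text \<open>
  For nonempty \<open>\<alpha>\<close> and \<open>\<beta>\<close>, the four flexions are
  \<open>upl \<beta> \<alpha> = \<^sub>\<beta>\<lceil>\<alpha>\<close>, \<open>upr \<alpha> \<beta> = \<alpha>\<rceil>\<^sub>\<beta>\<close>, \<open>lowl \<beta> \<alpha> = \<^sub>\<beta>\<lfloor>\<alpha>\<close>, \<open>lowr \<alpha> \<beta> = \<alpha>\<rfloor>\<^sub>\<beta>\<close>.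
\<close>

definition upl :: "'g word \<Rightarrow> 'g word \<Rightarrow> 'g word" where
  "upl \<beta> \<alpha> = (sum_list (map fst \<beta>) + fst (hd \<alpha>), snd (hd \<alpha>)) # tl \<alpha>"

definition upr :: "'g word \<Rightarrow> 'g word \<Rightarrow> 'g word" where
  "upr \<alpha> \<beta> = butlast \<alpha> @ [(fst (last \<alpha>) + sum_list (map fst \<beta>), snd (last \<alpha>))]"

definition lowl :: "('g :: ab_group_add) word \<Rightarrow> 'g word \<Rightarrow> 'g word" where
  "lowl \<beta> \<alpha> = map (\<lambda>(a, \<sigma>). (a, \<sigma> - snd (last \<beta>))) \<alpha>"

definition lowr :: "('g :: ab_group_add) word \<Rightarrow> 'g word \<Rightarrow> 'g word" where
  "lowr \<alpha> \<beta> = map (\<lambda>(a, \<sigma>). (a, \<sigma> - snd (hd \<beta>))) \<alpha>"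

definition arit :: "('g :: ab_group_add) mould \<Rightarrow> 'g mould \<Rightarrow> 'g mould" where
  "arit B A \<sigma>s =
     (if length \<sigma>s \<le> 1 then 0 else
       (\<Sum>(\<alpha>, \<beta>, \<gamma>) \<in> {(\<alpha>, \<beta>, \<gamma>). uword 0 \<sigma>s = \<alpha> @ \<beta> @ \<gamma> \<and> \<beta> \<noteq> [] \<and> \<gamma> \<noteq> []}.
          at_word A (\<alpha> @ upl \<beta> \<gamma>) * at_word B (lowr \<beta> \<gamma>))
     - (\<Sum>(\<alpha>, \<beta>, \<gamma>) \<in> {(\<alpha>, \<beta>, \<gamma>). uword 0 \<sigma>s = \<alpha> @ \<beta> @ \<gamma> \<and> \<alpha> \<noteq> [] \<and> \<beta> \<noteq> []}.
          at_word A (upr \<alpha> \<beta> @ \<gamma>) * at_word B (lowl \<alpha> \<beta>)))"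

definition preari :: "('g :: ab_group_add) mould \<Rightarrow> 'g mould \<Rightarrow> 'g mould" where
  "preari A B \<sigma>s = arit B A \<sigma>s + mould_mult A B \<sigma>s"

primrec preari_pow :: "nat \<Rightarrow> ('g :: ab_group_add) mould \<Rightarrow> 'g mould" where
  "preari_pow 0 M = mould_one"
| "preari_pow (Suc k) M = preari (preari_pow k M) M"

text \<open>
  For \<open>M \<in> ARI\<close> the mould \<open>preari_pow k M\<close> vanishes in depths below \<open>k\<close>, so that the sum over
  all \<open>k\<close> (\<^const>\<open>Sum_any\<close>) has finite support in each depth.
\<close>

definition expari :: "('g :: ab_group_add) mould \<Rightarrow> 'g mould" where
  "expari M \<sigma>s = Sum_any (\<lambda>k. preari_pow k M \<sigma>s / of_nat (fact k))"

end

(*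
  For fixed alternal M, the operator D : A |-> preari(A, M) is a coderivation for the coproduct dual
  to the shuffle product. Indeed, in a shuffle of two words the sum over the middle factor vanishes
  as soon as that factor mixes letters of both words; the middle factors taken from one word that
  act on a letter of the other word occur once from the left and once from the right, with opposite
  signs, and the remaining terms are D applied in either argument. Hence the iterates
  preari_k(M) = D^k(I) satisfy the binomial rule, so that their exponential sum is symmetral.
  Conversely, in depth r the mould expari(M) is M plus a term that depends only on depths below r,
  and two symmetral moulds that agree below depth r differ by an alternal mould in depth r; so a
  preimage of a symmetral mould can be built depth by depth.
*)
theory Submission
  imports Defs
begin

section \<open>Sums over deconcatenations and shuffles\<close>

text \<open>Iterating \<open>preari\<close> evaluates \<open>preari_pow k M\<close> at words that
  are already flexed, and there \<open>rsubst\<close> makes sense only if no denominator is sent to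
  zero. The shuffle combinatorics is therefore separated from the rational functions: it is done for
  arbitrary functions from words to a commutative ring, and moulds enter only through their values
  at words. The words that occur have independent upper entries, a property stable under
  permutation, passing to factors and flexion; on them evaluation commutes with substitution, so
  identities at the generic word carry over to all of them. The cancellation of opposite signs rests
  on a symmetry of the flexions: in \<open>\<alpha> \<beta> x \<gamma>\<close> and in
  \<open>\<alpha> x \<beta> \<gamma>\<close> alike, x absorbs the sum of the upper entries of
  \<beta>, and the lower entries of \<beta> are diminished by that of x. Neither operation depends
  on the order of the letters of \<beta>, which is why alternality applies to a flexed middle
  factor.\<close>

primrec deconc_sum :: "'a list \<Rightarrow> ('a list \<Rightarrow> 'a list \<Rightarrow> 'k) \<Rightarrow> 'k :: comm_monoid_add" where
  "deconc_sum [] f = f [] []"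
| "deconc_sum (a # w) f = f [] (a # w) + deconc_sum w (\<lambda>\<alpha>. f (a # \<alpha>))"

text \<open>Splits off the letter next to a flexing factor; the value 0 at the empty word encodes
  the condition that such a neighbour exists.\<close>

definition uncons_term :: "'a list \<Rightarrow> ('a \<Rightarrow> 'a list \<Rightarrow> 'k) \<Rightarrow> 'k :: zero" where
  "uncons_term w f = (case w of [] \<Rightarrow> 0 | x # v \<Rightarrow> f x v)"

definition shuf_sum :: "'a list \<Rightarrow> 'a list \<Rightarrow> ('a list \<Rightarrow> 'k) \<Rightarrow> 'k :: comm_monoid_add" where
  "shuf_sum \<omega> \<eta> f = (\<Sum>\<alpha>\<in>#shuffle \<omega> \<eta>. f \<alpha>)"

lemma uncons_term_simps [simp]:
  "uncons_term [] f = 0"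
  "uncons_term (x # v) f = f x v"
  by (simp_all add: uncons_term_def)

lemma shuffle_Nil_right [simp]: "shuffle \<omega> [] = {#\<omega>#}"
  by (cases \<omega>) auto

lemma shuf_sum_simps [simp]:
  "shuf_sum [] \<eta> f = f \<eta>"
  "shuf_sum \<omega> [] f = f \<omega>"
  "shuf_sum (a # \<omega>) (b # \<eta>) f =
     shuf_sum \<omega> (b # \<eta>) (\<lambda>w. f (a # w)) + shuf_sum (a # \<omega>) \<eta> (\<lambda>w. f (b # w))"
  by (simp_all add: shuf_sum_def image_mset.compositionality comp_def)

lemma deconc_Cons:
  "{(\<alpha>, \<beta>). a # w = \<alpha> @ \<beta>} =
     insert ([], a # w) ((\<lambda>(\<alpha>, \<beta>). (a # \<alpha>, \<beta>)) ` {(\<alpha>, \<beta>). w = \<alpha> @ \<beta>})"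
  by (auto simp: Cons_eq_append_conv)

lemma finite_deconc: "finite {(\<alpha>, \<beta>). w = \<alpha> @ \<beta>}"
proof (induction w)
  case Nil
  have "{(\<alpha>, \<beta>). [] = \<alpha> @ \<beta>} = {([], [])}" by auto
  then show ?case by simp
next
  case (Cons a w)
  then show ?case unfolding deconc_Cons by simp
qed

text \<open>The recursive form unfolds in step with the recursion of \<open>shuffle\<close>; the set
  form is the one in \<open>mould_mult\<close> and gives access to the rules for finite
  sums.\<close>

lemma deconc_sum_set:
  "deconc_sum w f = (\<Sum>(\<alpha>, \<beta>) \<in> {(\<alpha>, \<beta>). w = \<alpha> @ \<beta>}. f \<alpha> \<beta>)"
proof (induction w arbitrary: f)
  case Nil
  have "{(\<alpha>, \<beta>). [] = \<alpha> @ \<beta>} = {([], [])}" by auto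
  then show ?case by simp
next
  case (Cons a w)
  have inj: "inj_on (\<lambda>(\<alpha>, \<beta>). (a # \<alpha>, \<beta>)) {(\<alpha>, \<beta>). w = \<alpha> @ \<beta>}"
    by (auto simp: inj_on_def)
  show ?case
    unfolding deconc_Cons using finite_deconc[of w]
    by (subst sum.insert, simp, force, subst sum.reindex[OF inj])
      (simp add: Cons comp_def case_prod_unfold)
qed

lemma deconc_sum_cong:
  assumes "\<And>\<alpha> \<beta>. w = \<alpha> @ \<beta> \<Longrightarrow> f \<alpha> \<beta> = g \<alpha> \<beta>"
  shows "deconc_sum w f = deconc_sum w g"
  unfolding deconc_sum_set by (rule sum.cong) (use assms in auto)

text \<open>Cutting into three factors is cutting twice. This brings the triple sums of
  \<open>arit\<close> into recursive form, with the side conditions on empty factors turned into a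
  default value 0.\<close>

lemma deconc_sum_set3:
  "(\<Sum>(\<alpha>, \<beta>, \<gamma>) \<in> {(\<alpha>, \<beta>, \<gamma>). w = \<alpha> @ \<beta> @ \<gamma> \<and> P \<alpha> \<beta> \<gamma>}. f \<alpha> \<beta> \<gamma>) =
   deconc_sum w (\<lambda>\<alpha> v. deconc_sum v (\<lambda>\<beta> \<gamma>. if P \<alpha> \<beta> \<gamma> then f \<alpha> \<beta> \<gamma> else 0))"
proof -
  let ?S = "SIGMA p : {(\<alpha>, v). w = \<alpha> @ v}. {(\<beta>, \<gamma>). snd p = \<beta> @ \<gamma>}"
  let ?h = "\<lambda>(p, q). (fst p, q)"
  let ?g = "\<lambda>(\<alpha>, \<beta>, \<gamma>). if P \<alpha> \<beta> \<gamma> then f \<alpha> \<beta> \<gamma> else 0"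
  have img: "?h ` ?S = {(\<alpha>, \<beta>, \<gamma>). w = \<alpha> @ \<beta> @ \<gamma>}"
    by (force simp: image_iff)
  have inj: "inj_on ?h ?S" by (auto simp: inj_on_def)
  have fin: "finite ?S" by (intro finite_SigmaI finite_deconc)
  have "deconc_sum w (\<lambda>\<alpha> v. deconc_sum v (\<lambda>\<beta> \<gamma>. if P \<alpha> \<beta> \<gamma> then f \<alpha> \<beta> \<gamma> else 0)) =
    (\<Sum>p \<in> {(\<alpha>, v). w = \<alpha> @ v}. \<Sum>q \<in> {(\<beta>, \<gamma>). snd p = \<beta> @ \<gamma>}. ?g (?h (p, q)))"
    unfolding deconc_sum_set by (simp add: case_prod_unfold cong: if_cong)
  also have "\<dots> = (\<Sum>pq \<in> ?S. ?g (?h pq))"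
    by (subst sum.Sigma) (auto simp: case_prod_unfold finite_deconc[unfolded case_prod_unfold] cong: if_cong)
  also have "\<dots> = (\<Sum>t \<in> {(\<alpha>, \<beta>, \<gamma>). w = \<alpha> @ \<beta> @ \<gamma>}. ?g t)"
    unfolding img[symmetric] by (simp add: sum.reindex[OF inj])
  also have "\<dots> = (\<Sum>t \<in> {(\<alpha>, \<beta>, \<gamma>). w = \<alpha> @ \<beta> @ \<gamma> \<and> P \<alpha> \<beta> \<gamma>}. ?g t)"
    using finite_imageI[OF fin, of ?h] unfolding img
    by (intro sum.mono_neutral_right) (auto split: if_splits)
  also have "\<dots> = (\<Sum>(\<alpha>, \<beta>, \<gamma>) \<in> {(\<alpha>, \<beta>, \<gamma>). w = \<alpha> @ \<beta> @ \<gamma> \<and> P \<alpha> \<beta> \<gamma>}. f \<alpha> \<beta> \<gamma>)"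
    by (rule sum.cong) auto
  finally show ?thesis by simp
qed

section \<open>Linearity and reindexing of sums over deconcatenations\<close>

lemma deconc_sum_add:
  "deconc_sum w (\<lambda>\<alpha> \<beta>. f \<alpha> \<beta> + g \<alpha> \<beta>) = deconc_sum w f + deconc_sum w g"
  by (induction w arbitrary: f g) (simp_all add: ac_simps)

lemma deconc_sum_0 [simp]: "deconc_sum w (\<lambda>\<alpha> \<beta>. 0) = 0"
  by (induction w) simp_all

lemma deconc_sum_distrib:
  "deconc_sum w (\<lambda>\<alpha> \<beta>. c * f \<alpha> \<beta>) = (c :: 'k :: semiring_0) * deconc_sum w f"
  by (induction w arbitrary: f) (simp_all add: distrib_left)

lemma deconc_sum_swap:
  "deconc_sum w (\<lambda>\<alpha> \<beta>. deconc_sum v (\<lambda>\<gamma> \<delta>. f \<alpha> \<beta> \<gamma> \<delta>)) =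
   deconc_sum v (\<lambda>\<gamma> \<delta>. deconc_sum w (\<lambda>\<alpha> \<beta>. f \<alpha> \<beta> \<gamma> \<delta>))"
  by (induction w arbitrary: f) (simp_all add: deconc_sum_add)

lemma deconc_sum_map:
  "deconc_sum (map h w) f = deconc_sum w (\<lambda>\<alpha> \<beta>. f (map h \<alpha>) (map h \<beta>))"
  by (induction w arbitrary: f) simp_all

lemma deconc_sum_left_Nil:
  "deconc_sum w (\<lambda>\<alpha> \<beta>. if \<alpha> = [] then f \<alpha> \<beta> else 0) = f [] w"
  by (induction w arbitrary: f) simp_all

lemma deconc_sum_right_Nil:
  "deconc_sum w (\<lambda>\<alpha> \<beta>. if \<beta> = [] then f \<alpha> \<beta> else 0) = f w []"
  by (induction w arbitrary: f) simp_all

text \<open>A cut after a nonempty prefix is the same as a cut just before the last letter of that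
  prefix. The flexion \<open>upr\<close> acts on that letter, so this puts the right flexion sum in
  the shape of the left one, with the flexed letter split off explicitly.\<close>

lemma deconc_sum_unsnoc:
  "deconc_sum w (\<lambda>\<alpha> v. if \<alpha> = [] then 0 else f (butlast \<alpha>) (last \<alpha>) v) =
   deconc_sum w (\<lambda>\<alpha> v. uncons_term v (f \<alpha>))"
proof (induction w arbitrary: f)
  case Nil
  then show ?case by simp
next
  case (Cons a w)
  \<comment> \<open>The last letter of \<open>a # \<alpha>\<close> is a if \<alpha> is empty and the
    last letter of \<alpha> otherwise; the induction hypothesis handles the second part.\<close>
  have "deconc_sum w (\<lambda>\<alpha> v. f (butlast (a # \<alpha>)) (last (a # \<alpha>)) v) =
    deconc_sum w (\<lambda>\<alpha> v. (if \<alpha> = [] then f \<alpha> a v else 0) +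
      (if \<alpha> = [] then 0 else f (a # butlast \<alpha>) (last \<alpha>) v))"
    by (rule arg_cong[of _ _ "deconc_sum w"]) (auto simp: fun_eq_iff)
  also have "\<dots> = f [] a w + deconc_sum w (\<lambda>\<alpha> v. uncons_term v (f (a # \<alpha>)))"
    by (simp only: deconc_sum_add deconc_sum_left_Nil[of w "\<lambda>\<alpha>. f \<alpha> a"]
        Cons[of "\<lambda>\<alpha>. f (a # \<alpha>)"])
  finally show ?case by simp
qed

section \<open>Sums over shuffles and their interplay with deconcatenation\<close>

lemma shuf_sum_add:
  "shuf_sum \<omega> \<eta> (\<lambda>w. f w + g w) = shuf_sum \<omega> \<eta> f + shuf_sum \<omega> \<eta> g"
  by (simp add: shuf_sum_def sum_mset.distrib)

lemma shuf_sum_0 [simp]: "shuf_sum \<omega> \<eta> (\<lambda>w. 0) = 0"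
  by (simp add: shuf_sum_def)

lemma shuf_sum_diff:
  "shuf_sum \<omega> \<eta> (\<lambda>w. f w - g w) = shuf_sum \<omega> \<eta> f - (shuf_sum \<omega> \<eta> g :: 'k :: ab_group_add)"
  using shuf_sum_add[of \<omega> \<eta> "\<lambda>w. f w - g w" g] by (simp add: eq_diff_eq)

lemma shuf_sum_sum:
  "shuf_sum \<omega> \<eta> (\<lambda>w. \<Sum>i\<in>I. f i w) = (\<Sum>i\<in>I. shuf_sum \<omega> \<eta> (f i))"
  by (induction I rule: infinite_finite_induct) (simp_all add: shuf_sum_add)

lemma shuf_sum_distrib:
  "shuf_sum \<omega> \<eta> (\<lambda>w. c * f w) = (c :: 'k :: semiring_0) * shuf_sum \<omega> \<eta> f"
  by (simp add: shuf_sum_def sum_mset_distrib_left)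

lemma shuf_sum_distrib_right:
  "shuf_sum \<omega> \<eta> (\<lambda>w. f w * c) = shuf_sum \<omega> \<eta> f * (c :: 'k :: semiring_0)"
  by (simp add: shuf_sum_def sum_mset_distrib_right)

lemma shuf_sum_commute: "shuf_sum \<omega> \<eta> f = shuf_sum \<eta> \<omega> f"
  by (induction \<omega> \<eta> arbitrary: f rule: shuffle.induct) (simp_all add: add.commute)

lemma mset_shuffle: "w \<in># shuffle \<omega> \<eta> \<Longrightarrow> mset w = mset (\<omega> @ \<eta>)"
  by (induction \<omega> \<eta> arbitrary: w rule: shuffle.induct) auto

lemma shuf_sum_cong:
  assumes "\<And>w. mset w = mset (\<omega> @ \<eta>) \<Longrightarrow> f w = g w"
  shows "shuf_sum \<omega> \<eta> f = shuf_sum \<omega> \<eta> g"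
  unfolding shuf_sum_def
  by (intro arg_cong[of _ _ sum_mset] image_mset_cong assms mset_shuffle)

lemma shuf_sum_map:
  "shuf_sum (map h \<omega>) (map h \<eta>) f = shuf_sum \<omega> \<eta> (\<lambda>w. f (map h w))"
  by (induction \<omega> \<eta> arbitrary: f rule: shuffle.induct) simp_all

text \<open>A prefix of a shuffle is a shuffle of prefixes, and the remainder a shuffle of the
  remainders: deconcatenation and shuffle form a bialgebra.\<close>

lemma shuf_sum_deconc:
  "shuf_sum \<omega> \<eta> (\<lambda>w. deconc_sum w f) =
   deconc_sum \<omega> (\<lambda>\<omega>1 \<omega>2. deconc_sum \<eta> (\<lambda>\<eta>1 \<eta>2.
     shuf_sum \<omega>1 \<eta>1 (\<lambda>\<alpha>. shuf_sum \<omega>2 \<eta>2 (\<lambda>\<beta>. f \<alpha> \<beta>))))"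
  by (induction \<omega> \<eta> arbitrary: f rule: shuffle.induct)
    (simp_all add: deconc_sum_add shuf_sum_add ac_simps)

lemma shuf_sum_uncons:
  "shuf_sum \<omega> \<eta> (\<lambda>w. uncons_term w f) =
   uncons_term \<omega> (\<lambda>x \<omega>'. shuf_sum \<omega>' \<eta> (f x)) + uncons_term \<eta> (\<lambda>y \<eta>'. shuf_sum \<omega> \<eta>' (f y))"
  by (cases \<omega>; cases \<eta>) simp_all

text \<open>The marked letter x cuts every shuffle in two, and the cut induced on \<eta> is
  arbitrary. With x as the flexed letter this describes a flexed word shuffled with \<eta>.\<close>

lemma shuf_sum_middle:
  "shuf_sum (\<omega>1 @ x # \<omega>2) \<eta> f =
   deconc_sum \<eta> (\<lambda>\<eta>1 \<eta>2. shuf_sum \<omega>1 \<eta>1 (\<lambda>\<alpha>. shuf_sum \<omega>2 \<eta>2 (\<lambda>\<gamma>. f (\<alpha> @ x # \<gamma>))))"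
proof (induction \<omega>1 \<eta> arbitrary: f rule: shuffle.induct)
  case (1 \<eta>)
  \<comment> \<open>With \<omega>1 empty the recursion of \<open>shuffle\<close> no longer consumes
    \<eta>, although \<eta> may still put letters before x; hence a separate induction on
    \<eta>.\<close>
  show ?case
  proof (induction \<eta> arbitrary: f)
    case (Cons b \<eta>)
    then show ?case by simp
  qed simp
qed (simp_all add: deconc_sum_add shuf_sum_add ac_simps)

section \<open>The pre-Lie operation on functions of words\<close>

definition shift :: "'g \<Rightarrow> ('u \<times> 'g :: ab_group_add) list \<Rightarrow> ('u \<times> 'g) list" where
  "shift \<sigma> = map (\<lambda>(a, \<tau>). (a, \<tau> - \<sigma>))"

definition weight :: "('u :: comm_monoid_add \<times> 'g) list \<Rightarrow> 'u" where
  "weight w = sum_list (map fst w)"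

type_synonym ('u, 'g, 'k) word_fun = "('u \<times> 'g) list \<Rightarrow> 'k"

text \<open>One expression serves both flexion sums of \<open>arit\<close>: the side of x on which
  \<beta> stood leaves no trace in the value, only in the summation range.\<close>

definition flexion ::
  "('u :: comm_monoid_add, 'g :: ab_group_add, 'k :: comm_ring_1) word_fun \<Rightarrow> ('u, 'g, 'k) word_fun \<Rightarrow>
    ('u \<times> 'g) list \<Rightarrow> 'u \<times> 'g \<Rightarrow> ('u \<times> 'g) list \<Rightarrow> ('u \<times> 'g) list \<Rightarrow> 'k" where
  "flexion F A \<alpha> x \<beta> \<gamma> = F (shift (snd x) \<beta>) * A (\<alpha> @ (fst x + weight \<beta>, snd x) # \<gamma>)"

text \<open>The three sums are the left flexions, the right flexions and the product. Terms with
  empty \<beta> are included in the flexion sums and vanish when \<open>F [] = 0\<close>; this keeps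
  the shuffle computations free of case distinctions.\<close>

definition preari_fun ::
  "('u :: comm_monoid_add, 'g :: ab_group_add, 'k :: comm_ring_1) word_fun \<Rightarrow> ('u, 'g, 'k) word_fun \<Rightarrow>
    ('u, 'g, 'k) word_fun" where
  "preari_fun F A w =
     deconc_sum w (\<lambda>\<alpha> v. deconc_sum v (\<lambda>\<beta> v'. uncons_term v' (\<lambda>x \<gamma>. flexion F A \<alpha> x \<beta> \<gamma>)))
   - deconc_sum w (\<lambda>\<alpha> v. uncons_term v (\<lambda>x v'. deconc_sum v' (\<lambda>\<beta> \<gamma>. flexion F A \<alpha> x \<beta> \<gamma>)))
   + deconc_sum w (\<lambda>\<alpha> \<beta>. F \<beta> * A \<alpha>)"

text \<open>The relation ranges over all pairs of nonempty words, not only generic ones, because it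
  gets applied to shifted factors of arbitrary words.\<close>

definition alternal_fun :: "('u, 'g, 'k :: comm_monoid_add) word_fun \<Rightarrow> bool" where
  "alternal_fun F \<longleftrightarrow> F [] = 0 \<and> (\<forall>\<omega> \<eta>. \<omega> \<noteq> [] \<longrightarrow> \<eta> \<noteq> [] \<longrightarrow> shuf_sum \<omega> \<eta> F = 0)"

lemma weight_mset_cong: "mset v = mset w \<Longrightarrow> weight v = weight w"
  by (metis weight_def mset_map sum_mset_sum_list)

lemma shift_simps [simp]: "shift \<sigma> [] = []" "shift \<sigma> (v @ w) = shift \<sigma> v @ shift \<sigma> w"
   "(shift \<sigma> w = []) = (w = [])" "length (shift \<sigma> w) = length w"
  by (simp_all add: shift_def)

lemma uncons_term_add:
  "uncons_term w (\<lambda>x v. f x v + g x v) = uncons_term w f + (uncons_term w g :: 'k :: monoid_add)"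
  by (cases w) simp_all

lemma uncons_term_distrib:
  "uncons_term w (\<lambda>x v. c * f x v) = (c :: 'k :: semiring_0) * uncons_term w f"
  by (cases w) simp_all

lemma uncons_term_deconc:
  "uncons_term w (\<lambda>x v. deconc_sum u (f x v)) = deconc_sum u (\<lambda>\<alpha> \<beta>. uncons_term w (\<lambda>x v. f x v \<alpha> \<beta>))"
  by (cases w) simp_all

lemma preari_fun_add:
  "preari_fun F (\<lambda>w. A w + B w) w = preari_fun F A w + preari_fun F B w"
  by (simp add: preari_fun_def flexion_def distrib_left deconc_sum_add uncons_term_add)

lemma preari_fun_distrib:
  "preari_fun F (\<lambda>w. c * A w) w = c * preari_fun F A w"
proof -
  have "flexion F (\<lambda>w. c * A w) \<alpha> x \<beta> \<gamma> = c * flexion F A \<alpha> x \<beta> \<gamma>" "F \<beta> * (c * A \<alpha>) = c * (F \<beta> * A \<alpha>)"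
    for \<alpha> x \<beta> \<gamma> by (simp_all add: flexion_def mult.left_commute)
  then show ?thesis
    by (simp only: preari_fun_def deconc_sum_distrib uncons_term_distrib distrib_left right_diff_distrib)
qed

lemma preari_fun_0 [simp]: "preari_fun F (\<lambda>w. 0) w = 0"
  using preari_fun_distrib[of F 0] by simp

lemma preari_fun_sum:
  "preari_fun F (\<lambda>w. \<Sum>i\<in>I. A i w) w = (\<Sum>i\<in>I. preari_fun F (A i) w)"
  by (induction I rule: infinite_finite_induct) (simp_all add: preari_fun_add)

section \<open>The coderivation property\<close>

lemma shuf_sum_uncons2:
  "shuf_sum \<omega> \<eta> (\<lambda>\<beta>. uncons_term w (f \<beta>)) = uncons_term w (\<lambda>x v. shuf_sum \<omega> \<eta> (\<lambda>\<beta>. f \<beta> x v))"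
  by (cases w) simp_all

text \<open>The weight of \<open>\<beta>\<close> is the same for all terms of a shuffle, so that alternality applies.\<close>

lemma shuf_sum_flexion_mixed:
  assumes "alternal_fun F" "\<omega> \<noteq> []" "\<eta> \<noteq> []"
  shows "shuf_sum \<omega> \<eta> (\<lambda>\<beta>. flexion F A \<alpha> x \<beta> \<gamma>) = 0"
proof -
  have w: "weight w = weight (\<omega> @ \<eta>)" if "mset w = mset (\<omega> @ \<eta>)" for w :: "('a \<times> 'b) list"
    using that by (rule weight_mset_cong)
  have "shuf_sum \<omega> \<eta> (\<lambda>\<beta>. flexion F A \<alpha> x \<beta> \<gamma>) =
    shuf_sum \<omega> \<eta> (\<lambda>\<beta>. F (shift (snd x) \<beta>) * A (\<alpha> @ (fst x + weight (\<omega> @ \<eta>), snd x) # \<gamma>))"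
    by (rule shuf_sum_cong) (unfold flexion_def, subst w, assumption, rule refl)
  also have "\<dots> = shuf_sum (shift (snd x) \<omega>) (shift (snd x) \<eta>) F *
      A (\<alpha> @ (fst x + weight (\<omega> @ \<eta>), snd x) # \<gamma>)"
    unfolding shift_def by (simp add: shuf_sum_distrib_right shuf_sum_map)
  also have "\<dots> = 0" using assms by (simp add: alternal_fun_def)
  finally show ?thesis .
qed

lemma shuf_sum_shuf_sum_commute:
  "shuf_sum \<omega> \<eta> (\<lambda>\<alpha>. shuf_sum \<omega>' \<eta>' (\<lambda>\<beta>. f \<alpha> \<beta>)) =
   shuf_sum \<omega>' \<eta>' (\<lambda>\<beta>. shuf_sum \<omega> \<eta> (\<lambda>\<alpha>. f \<alpha> \<beta>))"
  by (induction \<omega> \<eta> arbitrary: f rule: shuffle.induct) (simp_all add: shuf_sum_add)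

lemma shuf_sum_deconc_const:
  "shuf_sum \<omega> \<eta> (\<lambda>\<alpha>. deconc_sum w (f \<alpha>)) = deconc_sum w (\<lambda>\<beta> \<gamma>. shuf_sum \<omega> \<eta> (\<lambda>\<alpha>. f \<alpha> \<beta> \<gamma>))"
  by (induction w arbitrary: f) (simp_all add: shuf_sum_add)

text \<open>A prefix of a shuffle draws on both words, on one of them, or on none; the first kind
  cancels by \<open>mixed\<close> and the last contributes nothing by \<open>empty\<close>, so only
  prefixes of a single word survive.\<close>

lemma shuf_sum_deconc_pure:
  assumes mixed: "\<And>\<omega> \<eta> \<gamma>. \<omega> \<noteq> [] \<Longrightarrow> \<eta> \<noteq> [] \<Longrightarrow> shuf_sum \<omega> \<eta> (\<lambda>\<beta>. f \<beta> \<gamma>) = 0"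
    and empty: "f [] = (\<lambda>\<gamma>. 0)"
  shows "shuf_sum \<omega> \<eta> (\<lambda>w. deconc_sum w f) =
    deconc_sum \<omega> (\<lambda>\<omega>1 \<omega>2. shuf_sum \<omega>2 \<eta> (f \<omega>1)) + deconc_sum \<eta> (\<lambda>\<eta>1 \<eta>2. shuf_sum \<omega> \<eta>2 (f \<eta>1))"
proof -
  \<comment> \<open>The hypothesis \<open>mixed\<close> sums over the prefix with the remainder
    fixed, so the two shuffle sums are interchanged first. If both prefixes are empty, both
    conditionals apply, and both give 0 because \<open>f []\<close> vanishes.\<close>
  have pure: "shuf_sum \<omega>1 \<eta>1 (\<lambda>\<beta>. shuf_sum \<omega>2 \<eta>2 (\<lambda>\<gamma>. f \<beta> \<gamma>)) =
      (if \<eta>1 = [] then shuf_sum \<omega>2 \<eta>2 (f \<omega>1) else 0) + (if \<omega>1 = [] then shuf_sum \<omega>2 \<eta>2 (f \<eta>1) else 0)"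
    for \<omega>1 \<omega>2 \<eta>1 \<eta>2
    using empty by (subst shuf_sum_shuf_sum_commute)
      (cases "\<omega>1 = []"; cases "\<eta>1 = []"; simp add: mixed empty)
  have 1: "deconc_sum \<omega> (\<lambda>\<omega>1 \<omega>2. deconc_sum \<eta> (\<lambda>\<eta>1 \<eta>2. if \<eta>1 = [] then shuf_sum \<omega>2 \<eta>2 (f \<omega>1) else 0))
    = deconc_sum \<omega> (\<lambda>\<omega>1 \<omega>2. shuf_sum \<omega>2 \<eta> (f \<omega>1))"
    by (simp add: deconc_sum_left_Nil[of \<eta> "\<lambda>_ \<eta>2. shuf_sum _ \<eta>2 _"])
  have 2: "deconc_sum \<omega> (\<lambda>\<omega>1 \<omega>2. deconc_sum \<eta> (\<lambda>\<eta>1 \<eta>2. if \<omega>1 = [] then shuf_sum \<omega>2 \<eta>2 (f \<eta>1) else 0))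
    = deconc_sum \<eta> (\<lambda>\<eta>1 \<eta>2. shuf_sum \<omega> \<eta>2 (f \<eta>1))"
    by (subst deconc_sum_swap) (simp add: deconc_sum_left_Nil[of \<omega> "\<lambda>_ \<omega>2. shuf_sum \<omega>2 _ _"])
  show ?thesis
    unfolding shuf_sum_deconc pure deconc_sum_add 1 2 ..
qed

text \<open>Mirror image for suffixes, needed for the product sum, where F is evaluated at the right
  factor.\<close>

lemma shuf_sum_deconc_pure_right:
  assumes mixed: "\<And>\<omega> \<eta> \<alpha>. \<omega> \<noteq> [] \<Longrightarrow> \<eta> \<noteq> [] \<Longrightarrow> shuf_sum \<omega> \<eta> (\<lambda>\<beta>. f \<alpha> \<beta>) = 0"
    and empty: "\<And>\<alpha>. f \<alpha> [] = 0"
  shows "shuf_sum \<omega> \<eta> (\<lambda>w. deconc_sum w f) =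
    deconc_sum \<omega> (\<lambda>\<omega>1 \<omega>2. shuf_sum \<omega>1 \<eta> (\<lambda>\<alpha>. f \<alpha> \<omega>2)) + deconc_sum \<eta> (\<lambda>\<eta>1 \<eta>2. shuf_sum \<omega> \<eta>1 (\<lambda>\<alpha>. f \<alpha> \<eta>2))"
proof -
  have pure: "shuf_sum \<omega>1 \<eta>1 (\<lambda>\<alpha>. shuf_sum \<omega>2 \<eta>2 (\<lambda>\<beta>. f \<alpha> \<beta>)) =
      (if \<eta>2 = [] then shuf_sum \<omega>1 \<eta>1 (\<lambda>\<alpha>. f \<alpha> \<omega>2) else 0) +
      (if \<omega>2 = [] then shuf_sum \<omega>1 \<eta>1 (\<lambda>\<alpha>. f \<alpha> \<eta>2) else 0)" for \<omega>1 \<omega>2 \<eta>1 \<eta>2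
    by (cases "\<omega>2 = []"; cases "\<eta>2 = []"; simp add: mixed empty)
  have 1: "deconc_sum \<omega> (\<lambda>\<omega>1 \<omega>2. deconc_sum \<eta> (\<lambda>\<eta>1 \<eta>2. if \<eta>2 = [] then shuf_sum \<omega>1 \<eta>1 (\<lambda>\<alpha>. f \<alpha> \<omega>2) else 0))
    = deconc_sum \<omega> (\<lambda>\<omega>1 \<omega>2. shuf_sum \<omega>1 \<eta> (\<lambda>\<alpha>. f \<alpha> \<omega>2))"
    by (simp add: deconc_sum_right_Nil[of \<eta> "\<lambda>\<eta>1 _. shuf_sum _ \<eta>1 _"])
  have 2: "deconc_sum \<omega> (\<lambda>\<omega>1 \<omega>2. deconc_sum \<eta> (\<lambda>\<eta>1 \<eta>2. if \<omega>2 = [] then shuf_sum \<omega>1 \<eta>1 (\<lambda>\<alpha>. f \<alpha> \<eta>2) else 0))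
    = deconc_sum \<eta> (\<lambda>\<eta>1 \<eta>2. shuf_sum \<omega> \<eta>1 (\<lambda>\<alpha>. f \<alpha> \<eta>2))"
    by (subst deconc_sum_swap) (simp add: deconc_sum_right_Nil[of \<omega> "\<lambda>\<omega>1 _. shuf_sum \<omega>1 _ _"])
  show ?thesis
    unfolding shuf_sum_deconc pure deconc_sum_add 1 2 ..
qed

lemma deconc_sum_shuf_sum_commute:
  "deconc_sum \<omega> (\<lambda>\<omega>1 \<omega>2. deconc_sum \<eta> (\<lambda>\<eta>1 \<eta>2. shuf_sum \<omega>1 \<eta>1 (f \<omega>2 \<eta>2))) =
   deconc_sum \<eta> (\<lambda>\<eta>1 \<eta>2. deconc_sum \<omega> (\<lambda>\<omega>1 \<omega>2. shuf_sum \<eta>1 \<omega>1 (f \<omega>2 \<eta>2)))"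
  by (subst deconc_sum_swap, intro deconc_sum_cong) (rule shuf_sum_commute)

text \<open>The flexed letter keeps its position, so it can serve as the marked letter of
  \<open>shuf_sum_middle\<close>. The right-hand side collects the terms whose flexing factor and
  flexed letter both come from the first word.\<close>

lemma flexion_shuf_sum:
  "flexion F (\<lambda>\<omega>. shuf_sum \<omega> \<eta> A) \<omega>1 x \<omega>2 \<omega>3 =
   deconc_sum \<eta> (\<lambda>\<eta>1 \<eta>2. shuf_sum \<omega>1 \<eta>1 (\<lambda>\<alpha>. shuf_sum \<omega>3 \<eta>2 (\<lambda>\<gamma>. flexion F A \<alpha> x \<omega>2 \<gamma>)))"
  by (simp add: flexion_def shuf_sum_middle shuf_sum_distrib deconc_sum_distrib)

lemma preari_fun_coderivation:
  assumes F: "alternal_fun F"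
  shows "shuf_sum \<omega> \<eta> (preari_fun F A) =
    preari_fun F (\<lambda>w. shuf_sum w \<eta> A) \<omega> + preari_fun F (\<lambda>w. shuf_sum \<omega> w A) \<eta>"
proof -
  define L1 where "L1 \<omega> \<eta> = deconc_sum \<omega> (\<lambda>\<omega>1 \<omega>'. deconc_sum \<omega>' (\<lambda>\<omega>2 \<omega>3. uncons_term \<omega>3 (\<lambda>x \<omega>4.
    flexion F (\<lambda>w. shuf_sum w \<eta> A) \<omega>1 x \<omega>2 \<omega>4)))" for \<omega> \<eta>
  define L2 where "L2 \<omega> \<eta> = deconc_sum \<omega> (\<lambda>\<omega>1 \<omega>'. uncons_term \<omega>' (\<lambda>x \<omega>''. deconc_sum \<omega>'' (\<lambda>\<omega>2 \<omega>3.
    flexion F (\<lambda>w. shuf_sum w \<eta> A) \<omega>1 x \<omega>2 \<omega>3)))" for \<omega> \<eta>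
  define L3 where "L3 \<omega> \<eta> = deconc_sum \<omega> (\<lambda>\<omega>1 \<omega>2. F \<omega>2 * shuf_sum \<omega>1 \<eta> A)" for \<omega> \<eta>
  \<comment> \<open>\<open>L\<close> and \<open>C\<close> collect the terms where the letter flexed by a piece of \<open>\<omega>\<close> comes from \<open>\<omega>\<close> and
    from \<open>\<eta>\<close>, respectively; \<open>C\<close> arises in both flexion sums and cancels.\<close>
  define C where "C \<omega> \<eta> = deconc_sum \<omega> (\<lambda>\<omega>1 \<omega>'. deconc_sum \<eta> (\<lambda>\<eta>1 \<eta>'.
    deconc_sum \<omega>' (\<lambda>\<omega>2 \<omega>3. uncons_term \<eta>' (\<lambda>y \<eta>4.
      shuf_sum \<omega>1 \<eta>1 (\<lambda>\<alpha>. shuf_sum \<omega>3 \<eta>4 (\<lambda>\<gamma>. flexion F A \<alpha> y \<omega>2 \<gamma>))))))" for \<omega> \<eta>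
  \<comment> \<open>\<open>H1\<close> and \<open>H2\<close> split the two flexion sums differently,
    following the order of reading: on the left \<beta> comes before x, so \<open>H1\<close> fixes
    that \<beta> comes from \<omega> and leaves the origin of x open; on the right x comes first, so
    \<open>H2\<close> fixes that x comes from \<omega> and leaves \<beta> open. This is why
    \<open>C\<close> enters \<open>H1\<close> and \<open>H2\<close> with its arguments
    exchanged.\<close>
  define H1 where "H1 \<omega> \<eta> = deconc_sum \<omega> (\<lambda>\<omega>1 \<omega>'. deconc_sum \<eta> (\<lambda>\<eta>1 \<eta>'. shuf_sum \<omega>1 \<eta>1 (\<lambda>\<alpha>.
    deconc_sum \<omega>' (\<lambda>\<omega>2 \<omega>3. shuf_sum \<omega>3 \<eta>' (\<lambda>v. uncons_term v (\<lambda>x \<gamma>. flexion F A \<alpha> x \<omega>2 \<gamma>))))))" for \<omega> \<eta>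
  define H2 where "H2 \<omega> \<eta> = deconc_sum \<omega> (\<lambda>\<omega>1 \<omega>'. deconc_sum \<eta> (\<lambda>\<eta>1 \<eta>'. shuf_sum \<omega>1 \<eta>1 (\<lambda>\<alpha>.
    uncons_term \<omega>' (\<lambda>x \<omega>''. shuf_sum \<omega>'' \<eta>' (\<lambda>v. deconc_sum v (\<lambda>\<beta> \<gamma>. flexion F A \<alpha> x \<beta> \<gamma>))))))" for \<omega> \<eta>

  have empty: "flexion F A \<alpha> x [] = (\<lambda>\<gamma>. 0)" for \<alpha> x
    using F by (simp add: flexion_def alternal_fun_def fun_eq_iff)
  note mixed = shuf_sum_flexion_mixed[OF F]
  have uncons_0: "uncons_term w (\<lambda>x v. 0) = (0 :: 'c)" for w :: "('a \<times> 'b) list"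
    by (cases w) simp_all

  have T1: "shuf_sum \<omega> \<eta> (\<lambda>w. deconc_sum w (\<lambda>\<alpha> v. deconc_sum v (\<lambda>\<beta> v'.
      uncons_term v' (\<lambda>x \<gamma>. flexion F A \<alpha> x \<beta> \<gamma>)))) = H1 \<omega> \<eta> + H1 \<eta> \<omega>"
  proof -
    have "shuf_sum \<omega>' \<eta>' (\<lambda>v. deconc_sum v (\<lambda>\<beta> v'. uncons_term v' (\<lambda>x \<gamma>. flexion F A \<alpha> x \<beta> \<gamma>))) =
      deconc_sum \<omega>' (\<lambda>\<omega>2 \<omega>3. shuf_sum \<omega>3 \<eta>' (\<lambda>v. uncons_term v (\<lambda>x \<gamma>. flexion F A \<alpha> x \<omega>2 \<gamma>))) +
      deconc_sum \<eta>' (\<lambda>\<eta>2 \<eta>3. shuf_sum \<eta>3 \<omega>' (\<lambda>v. uncons_term v (\<lambda>x \<gamma>. flexion F A \<alpha> x \<eta>2 \<gamma>)))"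
      for \<alpha> \<omega>' \<eta>'
      by (subst shuf_sum_deconc_pure)
        (simp_all add: shuf_sum_uncons2 mixed empty uncons_0 shuf_sum_commute[of \<omega>'])
    then show ?thesis
      unfolding H1_def deconc_sum_shuf_sum_commute[of \<eta> \<omega>]
      by (simp only: shuf_sum_deconc[of \<omega> \<eta>] shuf_sum_add deconc_sum_add)
  qed

  have T2: "shuf_sum \<omega> \<eta> (\<lambda>w. deconc_sum w (\<lambda>\<alpha> v. uncons_term v (\<lambda>x v'.
      deconc_sum v' (\<lambda>\<beta> \<gamma>. flexion F A \<alpha> x \<beta> \<gamma>)))) = H2 \<omega> \<eta> + H2 \<eta> \<omega>"
  proof -
    have "H2 \<eta> \<omega> = deconc_sum \<omega> (\<lambda>\<omega>1 \<omega>'. deconc_sum \<eta> (\<lambda>\<eta>1 \<eta>'. shuf_sum \<omega>1 \<eta>1 (\<lambda>\<alpha>.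
    uncons_term \<eta>' (\<lambda>x \<eta>''. shuf_sum \<omega>' \<eta>'' (\<lambda>v. deconc_sum v (\<lambda>\<beta> \<gamma>. flexion F A \<alpha> x \<beta> \<gamma>))))))"
      unfolding H2_def deconc_sum_shuf_sum_commute[of \<eta> \<omega>]
      by (subst shuf_sum_commute[where f = "\<lambda>v. deconc_sum v _"]) (rule refl)
    then show ?thesis
      by (simp only: H2_def shuf_sum_deconc[of \<omega> \<eta>] shuf_sum_uncons shuf_sum_add deconc_sum_add)
  qed

  have H1: "H1 \<omega> \<eta> = L1 \<omega> \<eta> + C \<omega> \<eta>" for \<omega> \<eta>
  proof -
    have "L1 \<omega> \<eta> = deconc_sum \<omega> (\<lambda>\<omega>1 \<omega>'. deconc_sum \<eta> (\<lambda>\<eta>1 \<eta>'. deconc_sum \<omega>' (\<lambda>\<omega>2 \<omega>3.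
      uncons_term \<omega>3 (\<lambda>x \<omega>4. shuf_sum \<omega>1 \<eta>1 (\<lambda>\<alpha>. shuf_sum \<omega>4 \<eta>' (\<lambda>\<gamma>. flexion F A \<alpha> x \<omega>2 \<gamma>))))))"
      unfolding L1_def flexion_shuf_sum uncons_term_deconc
      by (rule deconc_sum_cong, rule deconc_sum_swap)
    then show ?thesis
      unfolding H1_def C_def shuf_sum_deconc_const shuf_sum_uncons shuf_sum_add deconc_sum_add
        shuf_sum_uncons2 by simp
  qed

  have H2: "H2 \<omega> \<eta> = L2 \<omega> \<eta> + C \<eta> \<omega>" for \<omega> \<eta>
  proof -
    have pure: "shuf_sum \<omega>'' \<eta>' (\<lambda>v. deconc_sum v (\<lambda>\<beta> \<gamma>. flexion F A \<alpha> x \<beta> \<gamma>)) =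
      deconc_sum \<omega>'' (\<lambda>\<omega>2 \<omega>3. shuf_sum \<omega>3 \<eta>' (flexion F A \<alpha> x \<omega>2)) +
      deconc_sum \<eta>' (\<lambda>\<eta>2 \<eta>3. shuf_sum \<omega>'' \<eta>3 (flexion F A \<alpha> x \<eta>2))" for \<alpha> x \<omega>'' \<eta>'
      by (rule shuf_sum_deconc_pure) (simp_all add: mixed empty)
    have commute2: "shuf_sum u v (\<lambda>\<alpha>. shuf_sum u' v' (g \<alpha>)) = shuf_sum v u (\<lambda>\<alpha>. shuf_sum v' u' (g \<alpha>))"
      for u v u' v' and g :: "_ \<Rightarrow> _ \<Rightarrow> 'c"
      by (simp only: shuf_sum_commute[of u v] shuf_sum_commute[of u' v'])
    have "L2 \<omega> \<eta> = deconc_sum \<omega> (\<lambda>\<omega>1 \<omega>'. deconc_sum \<eta> (\<lambda>\<eta>1 \<eta>'. uncons_term \<omega>' (\<lambda>x \<omega>''.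
      deconc_sum \<omega>'' (\<lambda>\<omega>2 \<omega>3. shuf_sum \<omega>1 \<eta>1 (\<lambda>\<alpha>. shuf_sum \<omega>3 \<eta>' (\<lambda>\<gamma>. flexion F A \<alpha> x \<omega>2 \<gamma>))))))"
      unfolding L2_def flexion_shuf_sum uncons_term_deconc[symmetric]
      by (rule deconc_sum_cong)
        (auto simp: uncons_term_def intro!: deconc_sum_swap split: list.split)
    \<comment> \<open>Here the flexing piece is taken from \<eta> and stands to the right of x. The
      value agrees with that of a piece to the left of x, so this is literally the sum
      \<open>C\<close> of the left flexions with the two words exchanged.\<close>
    moreover have "C \<eta> \<omega> = deconc_sum \<omega> (\<lambda>\<omega>1 \<omega>'. deconc_sum \<eta> (\<lambda>\<eta>1 \<eta>'. uncons_term \<omega>' (\<lambda>x \<omega>''.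
      deconc_sum \<eta>' (\<lambda>\<eta>2 \<eta>3. shuf_sum \<omega>1 \<eta>1 (\<lambda>\<alpha>. shuf_sum \<omega>'' \<eta>3 (\<lambda>\<gamma>. flexion F A \<alpha> x \<eta>2 \<gamma>))))))"
      unfolding C_def uncons_term_deconc
      by (subst deconc_sum_swap, intro deconc_sum_cong arg_cong[of _ _ "uncons_term _"] ext)
        (rule commute2)
    ultimately show ?thesis
      unfolding H2_def pure shuf_sum_add deconc_sum_add uncons_term_add shuf_sum_uncons2 shuf_sum_deconc_const
      by simp
  qed

  have T3: "shuf_sum \<omega> \<eta> (\<lambda>w. deconc_sum w (\<lambda>\<alpha> \<beta>. F \<beta> * A \<alpha>)) = L3 \<omega> \<eta> + L3 \<eta> \<omega>"
    using F unfolding L3_def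
    by (subst shuf_sum_deconc_pure_right)
      (simp_all add: shuf_sum_distrib shuf_sum_distrib_right alternal_fun_def shuf_sum_commute[of \<omega>])

  have pf: "preari_fun F (\<lambda>w. shuf_sum w \<eta> A) \<omega> = L1 \<omega> \<eta> - L2 \<omega> \<eta> + L3 \<omega> \<eta>" for \<omega> \<eta>
    by (simp add: preari_fun_def L1_def L2_def L3_def)
  have "preari_fun F (\<lambda>w. shuf_sum \<omega> w A) \<eta> = preari_fun F (\<lambda>w. shuf_sum w \<omega> A) \<eta>"
    by (simp only: shuf_sum_commute[of \<omega>])
  then have "preari_fun F (\<lambda>w. shuf_sum \<omega> w A) \<eta> = L1 \<eta> \<omega> - L2 \<eta> \<omega> + L3 \<eta> \<omega>"
    by (simp add: pf)
  moreover have "shuf_sum \<omega> \<eta> (preari_fun F A) = (H1 \<omega> \<eta> + H1 \<eta> \<omega>) - (H2 \<omega> \<eta> + H2 \<eta> \<omega>) + (L3 \<omega> \<eta> + L3 \<eta> \<omega>)"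
    unfolding T1[symmetric] T2[symmetric] T3[symmetric] shuf_sum_add[symmetric] shuf_sum_diff[symmetric]
    by (simp only: preari_fun_def[abs_def])
  ultimately show ?thesis by (simp add: pf H1 H2)
qed

section \<open>Iterates and the exponential\<close>

primrec preari_fun_pow ::
  "nat \<Rightarrow> ('u :: comm_monoid_add, 'g :: ab_group_add, 'k :: comm_ring_1) word_fun \<Rightarrow> ('u, 'g, 'k) word_fun" where
  "preari_fun_pow 0 F = (\<lambda>w. if w = [] then 1 else 0)"
| "preari_fun_pow (Suc k) F = preari_fun F (preari_fun_pow k F)"

text \<open>The cutoff at \<open>length w\<close> loses nothing when \<open>F [] = 0\<close>: the
  k-th iterate then vanishes on words shorter than k.\<close>

definition expari_fun ::
  "('u :: comm_monoid_add, 'g :: ab_group_add, 'k :: field_char_0) word_fun \<Rightarrow> ('u, 'g, 'k) word_fun" where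
  "expari_fun F w = (\<Sum>k\<le>length w. preari_fun_pow k F w / fact k)"

text \<open>Leibniz rule for the powers of a coderivation. It starts from the unit, which is
  multiplicative because a shuffle is empty only if both words are.\<close>

lemma shuf_sum_preari_fun_pow:
  assumes "alternal_fun F"
  shows "shuf_sum \<omega> \<eta> (preari_fun_pow n F) =
    (\<Sum>i\<le>n. of_nat (n choose i) * (preari_fun_pow i F \<omega> * preari_fun_pow (n - i) F \<eta>))"
proof (induction n arbitrary: \<omega> \<eta>)
  case 0
  show ?case by (cases \<omega>; cases \<eta>) simp_all
next
  case (Suc n)
  let ?P = "\<lambda>i. preari_fun_pow i F"
  have "shuf_sum \<omega> \<eta> (?P (Suc n)) =
      preari_fun F (\<lambda>\<omega>. \<Sum>i\<le>n. of_nat (n choose i) * (?P i \<omega> * ?P (n - i) \<eta>)) \<omega> +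
      preari_fun F (\<lambda>\<eta>. \<Sum>i\<le>n. of_nat (n choose i) * (?P i \<omega> * ?P (n - i) \<eta>)) \<eta>"
    by (simp add: preari_fun_coderivation[OF assms] Suc)
  also have "\<dots> = (\<Sum>i\<le>n. of_nat (n choose i) * (?P (Suc i) \<omega> * ?P (n - i) \<eta>)) +
      (\<Sum>i\<le>n. of_nat (n choose i) * (?P i \<omega> * ?P (Suc n - i) \<eta>))"
  proof -
    have "preari_fun F (\<lambda>\<omega>. \<Sum>i\<le>n. of_nat (n choose i) * (?P i \<omega> * ?P (n - i) \<eta>)) \<omega> =
        preari_fun F (\<lambda>\<omega>. \<Sum>i\<le>n. (of_nat (n choose i) * ?P (n - i) \<eta>) * ?P i \<omega>) \<omega>"
      by (simp only: ac_simps)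
    moreover have "preari_fun F (\<lambda>\<eta>. \<Sum>i\<le>n. of_nat (n choose i) * (?P i \<omega> * ?P (n - i) \<eta>)) \<eta> =
        preari_fun F (\<lambda>\<eta>. \<Sum>i\<le>n. (of_nat (n choose i) * ?P i \<omega>) * ?P (n - i) \<eta>) \<eta>"
      by (simp only: ac_simps)
    ultimately show ?thesis
      by (simp only: preari_fun_sum preari_fun_distrib) (simp add: Suc_diff_le ac_simps)
  qed
  also have "\<dots> = (\<Sum>i\<le>Suc n. of_nat (Suc n choose i) * (?P i \<omega> * ?P (Suc n - i) \<eta>))"
  proof -
    \<comment> \<open>The second sum gains the index \<open>Suc n\<close> with coefficient 0 and is
      then shifted, so that equal products carry \<open>n choose i\<close> and
      \<open>n choose Suc i\<close>; Pascal's rule adds these up.\<close>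
    have "(\<Sum>i\<le>n. of_nat (n choose i) * (?P i \<omega> * ?P (Suc n - i) \<eta>)) =
        (\<Sum>i\<le>Suc n. of_nat (n choose i) * (?P i \<omega> * ?P (Suc n - i) \<eta>))"
      by (simp add: binomial_eq_0)
    also have "\<dots> = ?P 0 \<omega> * ?P (Suc n) \<eta> + (\<Sum>i\<le>n. of_nat (n choose Suc i) * (?P (Suc i) \<omega> * ?P (n - i) \<eta>))"
      by (subst sum.atMost_Suc_shift) (simp add: binomial_eq_0)
    finally show ?thesis
      by (subst sum.atMost_Suc_shift) (simp add: sum.distrib distrib_right)
  qed
  finally show ?case .
qed

section \<open>Dependence on depth\<close>

lemma preari_fun_cong:
  assumes "\<And>v. length v \<le> length w \<Longrightarrow> F v = F' v" "\<And>v. length v \<le> length w \<Longrightarrow> A v = A' v"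
  shows "preari_fun F A w = preari_fun F' A' w"
proof -
  have "flexion F A \<alpha> x \<beta> \<gamma> = flexion F' A' \<alpha> x \<beta> \<gamma>"
    if "length \<alpha> + length \<beta> + length \<gamma> < length w" for \<alpha> x \<beta> \<gamma>
    using that by (simp add: flexion_def assms)
  then show ?thesis
    unfolding preari_fun_def
    by (intro arg_cong2[of _ _ _ _ "(+)"] arg_cong2[of _ _ _ _ "(-)"] deconc_sum_cong)
      (auto simp: uncons_term_def assms split: list.split intro!: deconc_sum_cong)
qed

text \<open>With vanishing values at the empty word, every surviving term distributes the letters of
  w over two nonempty arguments, so both are strictly shorter than w.\<close>

lemma preari_fun_cong_less:
  assumes "\<And>v. length v < length w \<Longrightarrow> F v = F' v" "\<And>v. length v < length w \<Longrightarrow> A v = A' v"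
    and "F [] = 0" "F' [] = 0" "A [] = 0" "A' [] = 0"
  shows "preari_fun F A w = preari_fun F' A' w"
proof -
  have "flexion F A \<alpha> x \<beta> \<gamma> = flexion F' A' \<alpha> x \<beta> \<gamma>"
    if "length \<alpha> + length \<beta> + length \<gamma> < length w" for \<alpha> x \<beta> \<gamma>
    using that by (cases \<beta>) (simp_all add: flexion_def assms)
  moreover have "F \<beta> * A \<alpha> = F' \<beta> * A' \<alpha>" if "w = \<alpha> @ \<beta>" for \<alpha> \<beta>
    using that by (cases "\<alpha> = []"; cases "\<beta> = []") (simp_all add: assms)
  ultimately show ?thesis
    unfolding preari_fun_def
    by (intro arg_cong2[of _ _ _ _ "(+)"] arg_cong2[of _ _ _ _ "(-)"] deconc_sum_cong)
      (auto simp: uncons_term_def split: list.split intro!: deconc_sum_cong)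
qed

text \<open>Since \<open>F [] = 0\<close>, the argument of F uses up at least one letter. Each
  application of the operator thus raises the lowest depth of A, which makes the exponential series
  finite in each depth.\<close>

lemma preari_fun_const_0:
  assumes "\<And>v. length v < length w \<Longrightarrow> A v = 0" "F [] = 0"
  shows "preari_fun F A w = 0"
proof -
  have "flexion F A \<alpha> x \<beta> \<gamma> = 0"
    if "length \<alpha> + length \<beta> + length \<gamma> < length w" for \<alpha> x \<beta> \<gamma>
    using that by (cases \<beta>) (simp_all add: flexion_def assms)
  moreover have "F \<beta> * A \<alpha> = 0" if "w = \<alpha> @ \<beta>" for \<alpha> \<beta>
    using that by (cases "\<beta> = []") (simp_all add: assms)
  ultimately have "preari_fun F A w = preari_fun F (\<lambda>_. 0) w"
    unfolding preari_fun_def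
    by (intro arg_cong2[of _ _ _ _ "(+)"] arg_cong2[of _ _ _ _ "(-)"] deconc_sum_cong)
      (auto simp: uncons_term_def flexion_def split: list.split intro!: deconc_sum_cong)
  then show ?thesis by simp
qed

lemma preari_fun_pow_cong:
  assumes "\<And>v. length v \<le> length w \<Longrightarrow> F v = F' v"
  shows "preari_fun_pow k F w = preari_fun_pow k F' w"
  using assms
proof (induction k arbitrary: w)
  case (Suc k)
  then show ?case by (auto intro!: preari_fun_cong)
qed simp

lemma preari_fun_pow_eq_0:
  assumes "F [] = 0" "length w < k"
  shows "preari_fun_pow k F w = 0"
  using assms(2)
proof (induction k arbitrary: w)
  case (Suc k)
  then show ?case using assms(1) by (auto intro!: preari_fun_const_0)
qed simp

text \<open>The flexion sums of the unit vanish because a flexed word is never empty; only the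
  product of the unit with F remains.\<close>

lemma preari_fun_pow_1: "preari_fun_pow 1 F w = F w"
proof -
  have 0: "flexion F (\<lambda>w. if w = [] then 1 else 0) \<alpha> x \<beta> \<gamma> = 0" for \<alpha> x \<beta> \<gamma>
    by (simp add: flexion_def)
  have 1: "F \<beta> * (if \<alpha> = [] then 1 else 0) = (if \<alpha> = [] then F \<beta> else 0)" for \<alpha> \<beta> by simp
  have 2: "deconc_sum w (\<lambda>\<alpha> v. uncons_term v (\<lambda>x v'. 0)) = 0"
    by (rule trans[OF deconc_sum_cong deconc_sum_0]) (simp add: uncons_term_def split: list.split)
  have 3: "deconc_sum w (\<lambda>\<alpha> v. deconc_sum v (\<lambda>\<beta> v'. uncons_term v' (\<lambda>x v'. 0))) = 0"
    by (rule trans[OF deconc_sum_cong deconc_sum_0], rule trans[OF deconc_sum_cong deconc_sum_0])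
      (simp add: uncons_term_def split: list.split)
  show ?thesis
    unfolding One_nat_def preari_fun_pow.simps preari_fun_def 0 1
    by (simp add: deconc_sum_left_Nil[of w "\<lambda>_. F"] 2 3)
qed

lemma expari_fun_cong:
  assumes "\<And>v. length v \<le> length w \<Longrightarrow> F v = F' v"
  shows "expari_fun F w = expari_fun F' w"
  using preari_fun_pow_cong[of w F F'] assms by (simp add: expari_fun_def)

text \<open>For k at least 2 the preceding iterate has positive index, hence vanishes at the empty
  word, and only values in lower depth enter. The excluded iterate k = 1 is F itself.\<close>

lemma preari_fun_pow_cong_less:
  assumes "\<And>v. length v < length w \<Longrightarrow> F v = F' v" "F [] = 0" "F' [] = 0" "k \<noteq> 1"
  shows "preari_fun_pow k F w = preari_fun_pow k F' w"
proof (cases k)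
  case (Suc j)
  then have "0 < j" using assms(4) by simp
  then show ?thesis
    unfolding Suc preari_fun_pow.simps using assms
    by (intro preari_fun_cong_less preari_fun_pow_cong preari_fun_pow_eq_0) auto
qed simp

lemma expari_fun_diff:
  assumes "\<And>v. length v < length w \<Longrightarrow> F v = F' v" "F [] = 0" "F' [] = 0" "w \<noteq> []"
  shows "expari_fun F w - expari_fun F' w = F w - F' w"
proof -
  have "preari_fun_pow k F w / fact k - preari_fun_pow k F' w / fact k = (if k = 1 then F w - F' w else 0)" for k
    using preari_fun_pow_cong_less[of w F F' k] assms preari_fun_pow_1[of F w] preari_fun_pow_1[of F' w]
    by (cases "k = 1") auto
  then have "expari_fun F w - expari_fun F' w = (\<Sum>k\<le>length w. if k = 1 then F w - F' w else 0)"
    unfolding expari_fun_def sum_subtractf[symmetric] by simp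
  \<comment> \<open>The index k = 1 lies in the truncated range because w is nonempty.\<close>
  also have "\<dots> = F w - F' w" using assms(4) by (simp add: sum.delta Suc_le_eq)
  finally show ?thesis .
qed

text \<open>Dividing the binomial rule by factorials turns it into a Cauchy product, as for the
  exponential of a sum of commuting operators.\<close>

lemma expari_fun_symmetral:
  assumes F: "alternal_fun F"
  shows "shuf_sum \<omega> \<eta> (expari_fun F) = expari_fun F \<omega> * expari_fun F \<eta>"
proof -
  have F0: "F [] = 0" using F by (simp add: alternal_fun_def)
  let ?p = "length \<omega>" and ?q = "length \<eta>"
  define e where "e k w = preari_fun_pow k F w / fact k" for k w
  have e0: "e k w = 0" if "length w < k" for k w
    using that by (simp add: e_def preari_fun_pow_eq_0 F0)
  \<comment> \<open>All terms of the shuffle have the same length, so one cutoff serves for the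
    whole sum.\<close>
  have len: "length w = ?p + ?q" if "mset w = mset (\<omega> @ \<eta>)" for w
    using mset_eq_length[OF that] by simp
  have conv: "shuf_sum \<omega> \<eta> (e n) = (\<Sum>i\<le>n. e i \<omega> * e (n - i) \<eta>)" for n
  proof -
    have "shuf_sum \<omega> \<eta> (e n) = (1 / fact n) * shuf_sum \<omega> \<eta> (preari_fun_pow n F)"
      unfolding shuf_sum_distrib[symmetric] e_def by simp
    also have "\<dots> = (\<Sum>i\<le>n. e i \<omega> * e (n - i) \<eta>)"
      unfolding shuf_sum_preari_fun_pow[OF F] sum_distrib_left
      by (rule sum.cong) (auto simp: e_def binomial_fact field_simps)
    finally show ?thesis .
  qed
  have "shuf_sum \<omega> \<eta> (expari_fun F) = shuf_sum \<omega> \<eta> (\<lambda>w. \<Sum>n\<le>?p + ?q. e n w)"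
    by (rule shuf_sum_cong) (simp add: expari_fun_def e_def len)
  also have "\<dots> = (\<Sum>n\<le>?p + ?q. \<Sum>i\<le>n. e i \<omega> * e (n - i) \<eta>)"
    by (simp add: shuf_sum_sum conv)
  also have "\<dots> = (\<Sum>(i, j)\<in>{(i, j). i + j \<le> ?p + ?q}. e i \<omega> * e j \<eta>)"
    by (rule sum.triangle_reindex_eq[symmetric])
  \<comment> \<open>The triangle contains the rectangle, and outside the rectangle one of the two
    iterates is evaluated at a word too short for it.\<close>
  also have "\<dots> = (\<Sum>(i, j)\<in>{..?p} \<times> {..?q}. e i \<omega> * e j \<eta>)"
  proof (rule sum.mono_neutral_right)
    have "{(i, j). i + j \<le> ?p + ?q} \<subseteq> {..?p + ?q} \<times> {..?p + ?q}" by auto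
    then show "finite {(i, j). i + j \<le> ?p + ?q}" by (rule finite_subset) simp
  qed (auto, (metis e0 not_le)+)
  also have "\<dots> = expari_fun F \<omega> * expari_fun F \<eta>"
    by (simp add: expari_fun_def e_def sum_product sum.cartesian_product)
  finally show ?thesis .
qed

section \<open>Substitution in rational functions\<close>

text \<open>Makes rational functions an admissible value field for \<open>expari_fun\<close>, which
  divides by factorials.\<close>

instance fract :: ("{idom, ring_char_0}") field_char_0
proof
  show "inj (of_nat :: nat \<Rightarrow> 'a fract)"
    by (rule injI) (simp add: of_nat_fract eq_fract)
qed

lemma pconst_1 [simp]: "pconst 1 = 1"
  by (simp add: pconst_def)

lemma psubst_pvar [simp]: "psubst s (pvar i) = s i"
  by (simp add: pvar_def psubst_single)

lemma psubst_pconst [simp]: "psubst s (pconst c) = pconst c"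
  by (simp add: psubst_single[of s 0 c, folded pconst_def])

lemma psubst_1 [simp]: "psubst s 1 = 1"
  using psubst_pconst[of s 1] by simp

lemma psubst_uminus: "psubst s (- p) = - psubst s p"
  using psubst_add[of s p "- p"] by (simp add: eq_neg_iff_add_eq_0 add.commute)

lemma psubst_prod: "psubst s (\<Prod>i\<in>I. f i) = (\<Prod>i\<in>I. psubst s (f i))"
  by (induction I rule: infinite_finite_induct) (simp_all add: psubst_mult)

lemma psubst_power: "psubst s (p ^ n) = psubst s p ^ n"
  by (induction n) (simp_all add: psubst_mult)

lemma psubst_psubst: "psubst s (psubst t p) = psubst (\<lambda>i. psubst s (t i)) p"
  by (simp add: psubst_def[of t] psubst_def[of "\<lambda>i. psubst s (t i)"] psubst_sum psubst_mult
      psubst_prod psubst_power)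

lemma psubst_cong:
  assumes "\<And>i. i \<in> indets p \<Longrightarrow> s i = t i"
  shows "psubst s p = psubst t p"
  unfolding psubst_def
proof (intro sum.cong refl arg_cong2[of _ _ _ _ "(*)"] prod.cong)
  fix u i assume "u \<in> Poly_Mapping.keys p" "i \<in> Poly_Mapping.keys u"
  then have "i \<in> indets p" by (auto simp: indets_def)
  then show "s i ^ Poly_Mapping.lookup u i = t i ^ Poly_Mapping.lookup u i" by (simp add: assms)
qed

lemma pvar_power: "pvar i ^ n = Poly_Mapping.single (Poly_Mapping.single i n) 1"
  by (induction n) (simp_all add: pvar_def mult_single single_add[symmetric])

lemma prod_single: "(\<Prod>i\<in>I. Poly_Mapping.single (f i) 1 :: mpoly) = Poly_Mapping.single (\<Sum>i\<in>I. f i) 1"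
  by (induction I rule: infinite_finite_induct) (simp_all add: mult_single)

lemma poly_mapping_as_sum:
  "(t :: nat \<Rightarrow>\<^sub>0 nat) = (\<Sum>i\<in>Poly_Mapping.keys t. Poly_Mapping.single i (Poly_Mapping.lookup t i))"
  by (rule poly_mapping_eqI) (simp add: lookup_sum lookup_single when_def in_keys_iff sum.delta)

lemma psubst_id [simp]: "psubst pvar p = p"
proof -
  have "psubst pvar p = (\<Sum>t\<in>Poly_Mapping.keys p. Poly_Mapping.single t (Poly_Mapping.lookup p t))"
    unfolding psubst_def pvar_power prod_single poly_mapping_as_sum[symmetric]
    by (simp add: pconst_def mult_single)
  then show ?thesis using mpoly_as_sum[of p] by simp
qed

lemma indets_pconst [simp]: "indets (pconst c) = {}"
  by (simp add: indets_def pconst_def)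

lemma indets_1 [simp]: "indets 1 = {}"
  using indets_pconst[of 1] by simp

lemma indets_0 [simp]: "indets 0 = {}"
  by (simp add: indets_def)

lemma indets_pvar [simp]: "indets (pvar i) = {i}"
  by (simp add: indets_def pvar_def)

lemma indets_uminus [simp]: "indets (- p) = indets p"
  by (simp add: indets_def)

lemma indets_add: "indets (p + q) \<subseteq> indets p \<union> indets q"
  using Poly_Mapping.keys_add[of p q] by (auto simp: indets_def)

lemma indets_mult: "indets (p * q) \<subseteq> indets p \<union> indets q"
proof
  fix i assume "i \<in> indets (p * q)"
  then obtain t where t: "t \<in> Poly_Mapping.keys (p * q)" "i \<in> Poly_Mapping.keys t"
    by (auto simp: indets_def)
  then obtain a b where "t = a + b" "a \<in> Poly_Mapping.keys p" "b \<in> Poly_Mapping.keys q"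
    using keys_mult[of p q] by blast
  then show "i \<in> indets p \<union> indets q"
    using t(2) Poly_Mapping.keys_add[of a b] by (auto simp: indets_def)
qed

lemma indets_sum: "(\<And>x. x \<in> A \<Longrightarrow> indets (f x) \<subseteq> I) \<Longrightarrow> indets (\<Sum>x\<in>A. f x) \<subseteq> I"
proof (induction A rule: infinite_finite_induct)
  case (insert x A)
  then show ?case using indets_add[of "f x" "sum f A"] by simp blast
qed simp_all

lemma indets_prod: "(\<And>x. x \<in> A \<Longrightarrow> indets (f x) \<subseteq> I) \<Longrightarrow> indets (\<Prod>x\<in>A. f x) \<subseteq> I"
proof (induction A rule: infinite_finite_induct)
  case (insert x A)
  then show ?case using indets_mult[of "f x" "prod f A"] by simp blast
qed simp_all

lemma indets_power: "indets p \<subseteq> I \<Longrightarrow> indets (p ^ n) \<subseteq> I"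
  using indets_prod[of "{..<n}" "\<lambda>_. p" I] by simp

lemma indets_psubst:
  assumes "\<And>i. i \<in> indets p \<Longrightarrow> indets (s i) \<subseteq> I"
  shows "indets (psubst s p) \<subseteq> I"
  unfolding psubst_def
proof (rule indets_sum)
  fix t assume t: "t \<in> Poly_Mapping.keys p"
  have "indets (\<Prod>i\<in>Poly_Mapping.keys t. s i ^ Poly_Mapping.lookup t i) \<subseteq> I"
    using assms t by (intro indets_prod indets_power) (auto simp: indets_def)
  then show "indets (pconst (Poly_Mapping.lookup p t) *
      (\<Prod>i\<in>Poly_Mapping.keys t. s i ^ Poly_Mapping.lookup t i)) \<subseteq> I"
    using indets_mult by fastforce
qed

section \<open>The subfields of rational functions in the first m variables\<close>

lemma ratfuns_Fract:
  "q \<noteq> 0 \<Longrightarrow> indets p \<subseteq> {..<m} \<Longrightarrow> indets q \<subseteq> {..<m} \<Longrightarrow> Fraction_Field.Fract p q \<in> ratfuns m"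
  unfolding ratfuns_def by blast

lemma ratfunsE:
  assumes "f \<in> ratfuns m"
  obtains p q where "f = Fraction_Field.Fract p q" "q \<noteq> 0" "indets p \<subseteq> {..<m}" "indets q \<subseteq> {..<m}"
  using assms unfolding ratfuns_def by blast

lemma ratfuns_add:
  assumes "f \<in> ratfuns m" "g \<in> ratfuns m"
  shows "f + g \<in> ratfuns m"
proof -
  obtain p q where 1: "f = Fraction_Field.Fract p q" "q \<noteq> 0" "indets p \<subseteq> {..<m}" "indets q \<subseteq> {..<m}"
    using assms(1) by (rule ratfunsE)
  obtain p' q' where 2: "g = Fraction_Field.Fract p' q'" "q' \<noteq> 0" "indets p' \<subseteq> {..<m}" "indets q' \<subseteq> {..<m}"
    using assms(2) by (rule ratfunsE)
  have "indets (p * q' + p' * q) \<subseteq> {..<m}" "indets (q * q') \<subseteq> {..<m}"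
    using 1 2 indets_add[of "p * q'" "p' * q"] indets_mult[of p q'] indets_mult[of p' q]
      indets_mult[of q q'] by blast+
  then show ?thesis using 1 2 by (simp add: ratfuns_Fract)
qed

lemma ratfuns_mult:
  assumes "f \<in> ratfuns m" "g \<in> ratfuns m"
  shows "f * g \<in> ratfuns m"
proof -
  obtain p q where 1: "f = Fraction_Field.Fract p q" "q \<noteq> 0" "indets p \<subseteq> {..<m}" "indets q \<subseteq> {..<m}"
    using assms(1) by (rule ratfunsE)
  obtain p' q' where 2: "g = Fraction_Field.Fract p' q'" "q' \<noteq> 0" "indets p' \<subseteq> {..<m}" "indets q' \<subseteq> {..<m}"
    using assms(2) by (rule ratfunsE)
  have "indets (p * p') \<subseteq> {..<m}" "indets (q * q') \<subseteq> {..<m}"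
    using 1 2 indets_mult[of p p'] indets_mult[of q q'] by blast+
  then show ?thesis using 1 2 by (simp add: ratfuns_Fract)
qed

lemma ratfuns_const: "Fraction_Field.Fract (pconst a) (pconst b) \<in> ratfuns m" if "b \<noteq> 0"
proof -
  have "Poly_Mapping.lookup (pconst b) 0 \<noteq> 0" using that by (simp add: pconst_def)
  then have "pconst b \<noteq> 0" by (metis lookup_zero)
  then show ?thesis by (intro ratfuns_Fract) simp_all
qed

lemma ratfuns_0 [simp]: "0 \<in> ratfuns m" and ratfuns_1 [simp]: "1 \<in> ratfuns m"
  by (simp_all add: Zero_fract_def One_fract_def ratfuns_Fract)

lemma ratfuns_uminus: "f \<in> ratfuns m \<Longrightarrow> - f \<in> ratfuns m"
  by (elim ratfunsE) (simp add: ratfuns_Fract)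

lemma ratfuns_diff: "f \<in> ratfuns m \<Longrightarrow> g \<in> ratfuns m \<Longrightarrow> f - g \<in> ratfuns m"
  using ratfuns_add[of f m "- g"] by (simp add: ratfuns_uminus)

lemma ratfuns_sum: "(\<And>x. x \<in> A \<Longrightarrow> f x \<in> ratfuns m) \<Longrightarrow> (\<Sum>x\<in>A. f x) \<in> ratfuns m"
  by (induction A rule: infinite_finite_induct) (simp_all add: ratfuns_add)

lemma of_nat_mpoly: "of_nat n = pconst (of_nat n)"
  by (induction n) (simp_all add: pconst_def single_add One_fract_def)

lemma ratfuns_divide_of_nat: "f \<in> ratfuns m \<Longrightarrow> n \<noteq> 0 \<Longrightarrow> f / of_nat n \<in> ratfuns m"
  using ratfuns_mult[of f m "Fraction_Field.Fract (pconst 1) (pconst (of_nat n))"] ratfuns_const[of "of_nat n" 1 m]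
  by (simp add: divide_inverse of_nat_fract of_nat_mpoly)

text \<open>Exactly the condition that no denominator in the first m variables is killed, so that
  \<open>rsubst s\<close> is a field homomorphism on \<open>ratfuns m\<close>.\<close>

definition alg_indep :: "nat \<Rightarrow> (nat \<Rightarrow> mpoly) \<Rightarrow> bool" where
  "alg_indep m s \<longleftrightarrow> (\<forall>q. indets q \<subseteq> {..<m} \<longrightarrow> q \<noteq> 0 \<longrightarrow> psubst s q \<noteq> 0)"

lemma rsubst_add:
  assumes "alg_indep m s" "f \<in> ratfuns m" "g \<in> ratfuns m"
  shows "rsubst s (f + g) = rsubst s f + rsubst s g"
  using assms(2,3)
  by (elim ratfunsE) (use assms(1) in \<open>simp add: alg_indep_def rsubst_Fract psubst_mult psubst_add\<close>)

lemma rsubst_mult: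
  assumes "alg_indep m s" "f \<in> ratfuns m" "g \<in> ratfuns m"
  shows "rsubst s (f * g) = rsubst s f * rsubst s g"
  using assms(2,3)
  by (elim ratfunsE) (use assms(1) in \<open>simp add: alg_indep_def rsubst_Fract psubst_mult\<close>)

lemma rsubst_0 [simp]: "rsubst s 0 = 0" and rsubst_1 [simp]: "rsubst s 1 = 1"
  by (simp_all add: Zero_fract_def One_fract_def rsubst_Fract)

lemma rsubst_uminus:
  assumes "alg_indep m s" "f \<in> ratfuns m"
  shows "rsubst s (- f) = - rsubst s f"
  using assms(2)
  by (elim ratfunsE) (use assms(1) in \<open>simp add: alg_indep_def rsubst_Fract psubst_uminus\<close>)

lemma rsubst_diff:
  assumes "alg_indep m s" "f \<in> ratfuns m" "g \<in> ratfuns m"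
  shows "rsubst s (f - g) = rsubst s f - rsubst s g"
  using rsubst_add[OF assms(1,2) ratfuns_uminus[OF assms(3)]] rsubst_uminus[OF assms(1,3)] by simp

lemma rsubst_sum:
  assumes "alg_indep m s"
  shows "(\<And>x. x \<in> A \<Longrightarrow> f x \<in> ratfuns m) \<Longrightarrow> rsubst s (\<Sum>x\<in>A. f x) = (\<Sum>x\<in>A. rsubst s (f x))"
  by (induction A rule: infinite_finite_induct) (simp_all add: rsubst_add[OF assms] ratfuns_sum)

lemma rsubst_cong:
  assumes "alg_indep m s" "f \<in> ratfuns m" "\<And>i. i < m \<Longrightarrow> s i = t i"
  shows "rsubst s f = rsubst t f"
proof -
  obtain p q where f: "f = Fraction_Field.Fract p q" "q \<noteq> 0" "indets p \<subseteq> {..<m}" "indets q \<subseteq> {..<m}"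
    using assms(2) by (rule ratfunsE)
  have "psubst s p = psubst t p" "psubst s q = psubst t q"
    using f assms(3) by (auto intro!: psubst_cong)
  moreover have "psubst s q \<noteq> 0" using assms(1) f by (simp add: alg_indep_def)
  ultimately show ?thesis by (simp add: f(1) rsubst_Fract)
qed

lemma rsubst_in_ratfuns:
  assumes "alg_indep k t" "f \<in> ratfuns k" "\<And>i. i < k \<Longrightarrow> indets (t i) \<subseteq> {..<m}"
  shows "rsubst t f \<in> ratfuns m"
proof -
  obtain p q where f: "f = Fraction_Field.Fract p q" "q \<noteq> 0" "indets p \<subseteq> {..<k}" "indets q \<subseteq> {..<k}"
    using assms(2) by (rule ratfunsE)
  have "psubst t q \<noteq> 0" using assms(1) f by (simp add: alg_indep_def)
  moreover have "indets (psubst t p) \<subseteq> {..<m}" "indets (psubst t q) \<subseteq> {..<m}"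
    using f(3,4) assms(3) by (auto intro!: indets_psubst)
  ultimately show ?thesis by (simp add: f(1) rsubst_Fract ratfuns_Fract)
qed

text \<open>The inner entries must stay within the first m variables: only there does independence
  of s protect the denominator produced by t.\<close>

lemma rsubst_rsubst:
  assumes "alg_indep k t" "f \<in> ratfuns k" "\<And>i. i < k \<Longrightarrow> indets (t i) \<subseteq> {..<m}" "alg_indep m s"
  shows "rsubst s (rsubst t f) = rsubst (\<lambda>i. psubst s (t i)) f"
proof -
  obtain p q where f: "f = Fraction_Field.Fract p q" "q \<noteq> 0" "indets p \<subseteq> {..<k}" "indets q \<subseteq> {..<k}"
    using assms(2) by (rule ratfunsE)
  have 1: "psubst t q \<noteq> 0" using assms(1) f by (simp add: alg_indep_def)
  moreover have "indets (psubst t q) \<subseteq> {..<m}"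
    using f(4) assms(3) by (intro indets_psubst) auto
  ultimately have "psubst s (psubst t q) \<noteq> 0" using assms(4) by (simp add: alg_indep_def)
  then show ?thesis using 1 by (simp add: f(1) rsubst_Fract psubst_psubst)
qed

lemma rsubst_pvar:
  assumes "f \<in> ratfuns m"
  shows "rsubst pvar f = f"
  using assms by (elim ratfunsE) (simp add: rsubst_Fract)

section \<open>Words with independent upper entries\<close>

text \<open>Independence of the upper entries, expressed by a witness: a substitution that turns
  them into distinct variables. In this form stability under permutation, factors and flexion
  follows by exhibiting substitutions, without linear algebra.\<close>

definition admissible :: "'g word \<Rightarrow> bool" where
  "admissible w \<longleftrightarrow> (\<exists>t. distinct (map (\<lambda>x. psubst t (fst x)) w) \<and>
     (\<forall>x\<in>set w. psubst t (fst x) \<in> range pvar))"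

definition word_in :: "nat \<Rightarrow> 'g word \<Rightarrow> bool" where
  "word_in m w \<longleftrightarrow> (\<forall>x\<in>set w. indets (fst x) \<subseteq> {..<m})"

definition entries :: "'g word \<Rightarrow> nat \<Rightarrow> mpoly" where
  "entries w = (\<lambda>i. if i < length w then fst (w ! i) else 0)"

abbreviation lsubst :: "(nat \<Rightarrow> mpoly) \<Rightarrow> mpoly \<times> 'g \<Rightarrow> mpoly \<times> 'g" where
  "lsubst s \<equiv> \<lambda>x. (psubst s (fst x), snd x)"

lemma at_word_entries: "at_word M w = rsubst (entries w) (M (map snd w))"
  by (simp add: at_word_def entries_def)

lemma inj_pvar: "inj pvar"
proof (rule injI)
  fix i j assume "pvar i = pvar j"
  then have "indets (pvar i) = indets (pvar j)" by simp
  then show "i = j" by simp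
qed

lemma uword_simps [simp]:
  "length (uword n \<sigma>s) = length \<sigma>s"
  "map snd (uword n \<sigma>s) = \<sigma>s"
  "(uword n \<sigma>s = []) = (\<sigma>s = [])"
  by (auto simp: uword_def zip_eq_Nil_iff)

lemma map_fst_uword: "map fst (uword n \<sigma>s) = map pvar [n..<n + length \<sigma>s]"
  by (simp add: uword_def)

lemma uword_append: "uword n (\<sigma>s @ \<tau>s) = uword n \<sigma>s @ uword (n + length \<sigma>s) \<tau>s"
proof -
  have "[n..<n + length (\<sigma>s @ \<tau>s)] = [n..<n + length \<sigma>s] @ [n + length \<sigma>s..<n + length \<sigma>s + length \<tau>s]"
    unfolding length_append add.assoc[symmetric] by (rule upt_add_eq_append) simp
  then have "uword n (\<sigma>s @ \<tau>s) =
      zip (map pvar ([n..<n + length \<sigma>s] @ [n + length \<sigma>s..<n + length \<sigma>s + length \<tau>s])) (\<sigma>s @ \<tau>s)"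
    by (simp only: uword_def)
  also have "\<dots> = uword n \<sigma>s @ uword (n + length \<sigma>s) \<tau>s"
    unfolding uword_def map_append by (rule zip_append) simp
  finally show ?thesis .
qed

lemma admissible_uword [simp]: "admissible (uword n \<sigma>s)"
  unfolding admissible_def
proof (intro exI conjI ballI)
  have "map (\<lambda>x. psubst pvar (fst x)) (uword n \<sigma>s) = map pvar [n..<n + length \<sigma>s]"
    unfolding map_fst_uword[symmetric] by simp
  then show "distinct (map (\<lambda>x. psubst pvar (fst x)) (uword n \<sigma>s))"
    using inj_pvar by (simp add: distinct_map inj_on_def)
  fix x assume "x \<in> set (uword n \<sigma>s)"
  then have "fst x \<in> set (map fst (uword n \<sigma>s))" by simp
  then show "psubst pvar (fst x) \<in> range pvar" unfolding map_fst_uword by auto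
qed

lemma admissible_uword_pair [simp]: "admissible (uword 0 \<sigma>s @ uword (length \<sigma>s) \<tau>s)"
  using admissible_uword[of 0 "\<sigma>s @ \<tau>s"] by (simp only: uword_append add_0)

lemma word_in_uword: "n + length \<sigma>s \<le> m \<Longrightarrow> word_in m (uword n \<sigma>s)"
  unfolding word_in_def
proof
  fix x assume *: "n + length \<sigma>s \<le> m" "x \<in> set (uword n \<sigma>s)"
  then have "fst x \<in> set (map fst (uword n \<sigma>s))" by simp
  then show "indets (fst x) \<subseteq> {..<m}" using * unfolding map_fst_uword by auto
qed

lemma admissible_mset: "mset v = mset w \<Longrightarrow> admissible v = admissible w"
proof -
  assume *: "mset v = mset w"
  have "distinct (map f v) = distinct (map f w)" for f :: "mpoly \<times> 'a \<Rightarrow> mpoly"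
    by (rule mset_eq_imp_distinct_iff) (simp add: *)
  then show ?thesis unfolding admissible_def mset_eq_setD[OF *] by simp
qed

lemma word_in_mset: "mset v = mset w \<Longrightarrow> word_in m v = word_in m w"
  unfolding word_in_def by (drule mset_eq_setD) simp

lemma admissible_append: "admissible (v @ w) \<Longrightarrow> admissible v \<and> admissible w"
  unfolding admissible_def by (elim exE, intro conjI; rule exI) auto

lemma word_in_append [simp]: "word_in m (v @ w) \<longleftrightarrow> word_in m v \<and> word_in m w"
  by (auto simp: word_in_def)

lemma admissible_shift [simp]: "admissible (shift \<sigma> w) = admissible w"
proof -
  have "map (\<lambda>x. psubst t (fst x)) (shift \<sigma> w) = map (\<lambda>x. psubst t (fst x)) w" for t
    by (simp add: shift_def case_prod_beta)
  moreover have "(\<forall>x\<in>set (shift \<sigma> w). psubst t (fst x) \<in> range pvar) \<longleftrightarrow>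
      (\<forall>x\<in>set w. psubst t (fst x) \<in> range pvar)" for t
    by (simp add: shift_def case_prod_beta)
  ultimately show ?thesis by (simp add: admissible_def)
qed

lemma word_in_shift [simp]: "word_in m (shift \<sigma> w) = word_in m w"
  by (force simp: word_in_def shift_def)

lemma psubst_weight: "psubst s (weight w) = sum_list (map (\<lambda>x. psubst s (fst x)) w)"
  by (induction w) (simp_all add: weight_def psubst_add)

lemma word_in_flexion:
  assumes "word_in m (\<alpha> @ \<beta> @ x # \<gamma>)"
  shows "word_in m (\<alpha> @ (fst x + weight \<beta>, \<sigma>) # \<gamma>)"
proof -
  have "\<forall>y\<in>set \<beta>. indets (fst y) \<subseteq> {..<m}" using assms by (auto simp: word_in_def)
  then have "indets (weight \<beta>) \<subseteq> {..<m}"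
  proof (induction \<beta>)
    case (Cons y \<beta>)
    then show ?case using indets_add[of "fst y" "weight \<beta>"] by (simp add: weight_def) blast
  qed (simp add: weight_def)
  then show ?thesis
    using assms indets_add[of "fst x" "weight \<beta>"] by (auto simp: word_in_def)
qed

text \<open>Sending the variables of \<open>\<beta>\<close> to zero undoes the flexion by \<open>\<beta>\<close>.\<close>

lemma admissible_flexion:
  assumes "admissible (\<alpha> @ \<beta> @ x # \<gamma>)"
  shows "admissible (\<alpha> @ (fst x + weight \<beta>, \<sigma>) # \<gamma>)"
proof -
  obtain t where t: "distinct (map (\<lambda>x. psubst t (fst x)) (\<alpha> @ \<beta> @ x # \<gamma>))"
    "\<forall>y\<in>set (\<alpha> @ \<beta> @ x # \<gamma>). psubst t (fst y) \<in> range pvar"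
    using assms unfolding admissible_def by blast
  define B where "B = (\<lambda>y. psubst t (fst y)) ` set \<beta>"
  define r where "r i = (if pvar i \<in> B then 0 else pvar i)" for i
  define t' where "t' i = psubst r (t i)" for i
  have t': "psubst t' p = psubst r (psubst t p)" for p
    by (simp add: psubst_psubst t'_def[abs_def])
  \<comment> \<open>Distinctness of the images is what saves the letters outside \<beta> when the
    variables of \<beta> are set to zero.\<close>
  have keep: "psubst t' (fst y) = psubst t (fst y)" if "y \<in> set (\<alpha> @ x # \<gamma>)" for y
  proof -
    have "psubst t (fst y) \<notin> B" using t(1) that by (auto simp: B_def)
    moreover have "y \<in> set (\<alpha> @ \<beta> @ x # \<gamma>)" using that by auto
    then obtain i where "psubst t (fst y) = pvar i" using t(2) by blast
    ultimately show ?thesis by (simp add: t' r_def)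
  qed
  have kill: "psubst t' (fst y) = 0" if "y \<in> set \<beta>" for y
  proof -
    have "psubst t (fst y) \<in> B" using that by (auto simp: B_def)
    moreover have "y \<in> set (\<alpha> @ \<beta> @ x # \<gamma>)" using that by auto
    then obtain i where "psubst t (fst y) = pvar i" using t(2) by blast
    ultimately show ?thesis by (simp add: t' r_def)
  qed
  have "psubst t' (weight \<beta>) = 0"
    using kill by (simp add: psubst_weight sum_list_0 cong: map_cong)
  then have x: "psubst t' (fst x + weight \<beta>) = psubst t (fst x)"
    using keep[of x] by (simp add: psubst_add)
  have 1: "map (\<lambda>y. psubst t' (fst y)) (\<alpha> @ (fst x + weight \<beta>, \<sigma>) # \<gamma>) =
      map (\<lambda>y. psubst t (fst y)) (\<alpha> @ x # \<gamma>)"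
    using keep x by simp
  have 2: "distinct (map (\<lambda>y. psubst t (fst y)) (\<alpha> @ x # \<gamma>))" using t(1) by auto
  have 3: "\<forall>y\<in>set (\<alpha> @ (fst x + weight \<beta>, \<sigma>) # \<gamma>). psubst t' (fst y) \<in> range pvar"
    using t(2) keep x by auto
  show ?thesis
    unfolding admissible_def
  proof (intro exI conjI)
    show "distinct (map (\<lambda>y. psubst t' (fst y)) (\<alpha> @ (fst x + weight \<beta>, \<sigma>) # \<gamma>))"
      unfolding 1 by (rule 2)
  qed (rule 3)
qed

text \<open>Substituting w, then applying the witness t and renaming variables gives back the
  original polynomial, so the first substitution has trivial kernel.\<close>

lemma admissible_alg_indep:
  assumes "admissible w"
  shows "alg_indep (length w) (entries w)"
proof -
  obtain t where t: "distinct (map (\<lambda>x. psubst t (fst x)) w)"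
    "\<forall>x\<in>set w. psubst t (fst x) \<in> range pvar"
    using assms unfolding admissible_def by blast
  define n where "n i = inv pvar (psubst t (fst (w ! i)))" for i
  have n: "psubst t (fst (w ! i)) = pvar (n i)" if "i < length w" for i
    using t(2) that unfolding n_def by (metis f_inv_into_f nth_mem)
  have inj: "inj_on n {..<length w}"
    using t(1) n by (intro inj_onI) (simp add: distinct_conv_nth, metis)
  \<comment> \<open>Renames the variable reached at position i back to \<open>pvar i\<close>; the
    inverse is taken on the positions of w, where \<open>n\<close> is injective.\<close>
  define r where "r j = pvar (inv_into {..<length w} n j)" for j
  have "psubst r (psubst t (psubst (entries w) q)) = q" if "indets q \<subseteq> {..<length w}" for q
  proof -
    have "psubst r (psubst t (psubst (entries w) q)) = psubst pvar q"
      unfolding psubst_psubst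
    proof (rule psubst_cong)
      fix i assume "i \<in> indets q"
      then have i: "i < length w" using that by auto
      then show "psubst (\<lambda>i. psubst r (t i)) (entries w i) = pvar i"
        by (simp add: entries_def n r_def inv_into_f_f[OF inj] flip: psubst_psubst)
    qed
    then show ?thesis by simp
  qed
  then show ?thesis unfolding alg_indep_def by (metis psubst_0)
qed

section \<open>Evaluation of moulds and its compatibility with substitution\<close>

lemma at_word_in_ratfuns:
  assumes "M \<in> BIMU" "admissible w" "word_in m w"
  shows "at_word M w \<in> ratfuns m"
  unfolding at_word_entries
proof (rule rsubst_in_ratfuns)
  show "alg_indep (length w) (entries w)" using assms(2) by (rule admissible_alg_indep)
  show "M (map snd w) \<in> ratfuns (length w)"
    using assms(1) unfolding BIMU_def by (metis (mono_tags) length_map mem_Collect_eq)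
qed (use assms(3) in \<open>auto simp: word_in_def entries_def\<close>)

text \<open>Evaluation is itself a substitution, so this is functoriality. It transports identities
  from the generic word to any admissible one.\<close>

lemma rsubst_at_word:
  assumes "M \<in> BIMU" "admissible w" "word_in m w" "alg_indep m s"
  shows "rsubst s (at_word M w) = at_word M (map (lsubst s) w)"
proof -
  have "M (map snd w) \<in> ratfuns (length w)"
    using assms(1) unfolding BIMU_def by (metis (mono_tags) length_map mem_Collect_eq)
  moreover have "i < length w \<Longrightarrow> indets (entries w i) \<subseteq> {..<m}" for i
    using assms(3) by (auto simp: word_in_def entries_def)
  ultimately have "rsubst s (rsubst (entries w) (M (map snd w))) =
      rsubst (\<lambda>i. psubst s (entries w i)) (M (map snd w))"
    using admissible_alg_indep[OF assms(2)] assms(4) by (intro rsubst_rsubst)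
  moreover have "(\<lambda>i. psubst s (entries w i)) = entries (map (lsubst s) w)"
    by (auto simp: entries_def fun_eq_iff)
  moreover have "map snd (map (lsubst s) w) = map snd w" by simp
  ultimately show ?thesis unfolding at_word_entries by metis
qed

text \<open>Past the end of the word \<open>entries\<close> is 0 and not a variable, so it agrees
  with \<open>pvar\<close> only on the variables that \<open>M \<sigma>s\<close> may contain; that
  suffices.\<close>

lemma at_word_uword:
  assumes "M \<in> BIMU"
  shows "at_word M (uword 0 \<sigma>s) = M \<sigma>s"
proof -
  have M: "M \<sigma>s \<in> ratfuns (length \<sigma>s)" using assms by (simp add: BIMU_def)
  have "fst (uword 0 \<sigma>s ! i) = pvar i" if "i < length \<sigma>s" for i
    using that by (simp add: uword_def)
  then have "rsubst (entries (uword 0 \<sigma>s)) (M \<sigma>s) = rsubst pvar (M \<sigma>s)"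
    using admissible_alg_indep[OF admissible_uword, of 0 \<sigma>s] M
    by (intro rsubst_cong[of "length \<sigma>s"]) (simp_all add: entries_def)
  then show ?thesis by (simp add: at_word_entries rsubst_pvar[OF M])
qed

lemma lsubst_uword:
  "map (lsubst (entries w)) (uword 0 (map snd w)) = w"
  by (rule nth_equalityI) (simp_all add: uword_def entries_def)

text \<open>Membership and equation travel together: additivity of \<open>rsubst\<close> requires
  summands in \<open>ratfuns m\<close>, and the joint statement can be applied to nested sums layer
  by layer.\<close>

lemma deconc_sum_rsubst:
  assumes s: "alg_indep m s"
    and "\<And>\<alpha> \<beta>. w = \<alpha> @ \<beta> \<Longrightarrow> f \<alpha> \<beta> \<in> ratfuns m \<and> rsubst s (f \<alpha> \<beta>) = g \<alpha> \<beta>"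
  shows "deconc_sum w f \<in> ratfuns m \<and> rsubst s (deconc_sum w f) = deconc_sum w g"
proof
  show "deconc_sum w f \<in> ratfuns m"
    unfolding deconc_sum_set by (intro ratfuns_sum) (use assms(2) in auto)
  show "rsubst s (deconc_sum w f) = deconc_sum w g"
    unfolding deconc_sum_set
    by (subst rsubst_sum[OF s]) (use assms(2) in \<open>auto intro!: sum.cong\<close>)
qed

lemma uncons_term_rsubst:
  assumes "\<And>x v. w = x # v \<Longrightarrow> f x v \<in> ratfuns m \<and> rsubst s (f x v) = g x v"
  shows "uncons_term w f \<in> ratfuns m \<and> rsubst s (uncons_term w f) = uncons_term w g"
  using assms by (cases w) simp_all

lemma uncons_term_map: "uncons_term (map h w) f = uncons_term w (\<lambda>x v. f (h x) (map h v))"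
  by (cases w) simp_all

lemma shift_lsubst: "shift \<sigma> (map (lsubst s) w) = map (lsubst s) (shift \<sigma> w)"
  by (simp add: shift_def case_prod_beta)

lemma preari_fun_rsubst:
  assumes A: "A \<in> BIMU" and B: "B \<in> BIMU" and w: "admissible w" "word_in m w" and s: "alg_indep m s"
  shows "preari_fun (at_word B) (at_word A) w \<in> ratfuns m \<and>
    rsubst s (preari_fun (at_word B) (at_word A) w) =
      preari_fun (at_word B) (at_word A) (map (lsubst s) w)"
proof -
  let ?h = "lsubst s"
  let ?f = "flexion (at_word B) (at_word A)"
  \<comment> \<open>The assumption is on multisets so as to cover \<beta> on either side of x;
    admissibility is insensitive to the order of letters.\<close>
  have flex: "?f \<alpha> x \<beta> \<gamma> \<in> ratfuns m \<and>
      rsubst s (?f \<alpha> x \<beta> \<gamma>) = ?f (map ?h \<alpha>) (?h x) (map ?h \<beta>) (map ?h \<gamma>)"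
    if "mset w = mset (\<alpha> @ \<beta> @ x # \<gamma>)" for \<alpha> x \<beta> \<gamma>
  proof -
    have adm: "admissible (\<alpha> @ \<beta> @ x # \<gamma>)" "word_in m (\<alpha> @ \<beta> @ x # \<gamma>)"
      using w admissible_mset[OF that] word_in_mset[OF that] by simp_all
    then have \<beta>: "admissible (shift (snd x) \<beta>)" "word_in m (shift (snd x) \<beta>)"
      by (auto dest!: admissible_append)
    have \<alpha>: "admissible (\<alpha> @ (fst x + weight \<beta>, snd x) # \<gamma>)" "word_in m (\<alpha> @ (fst x + weight \<beta>, snd x) # \<gamma>)"
      using adm by (auto intro: admissible_flexion word_in_flexion simp del: word_in_append)
    have weight: "weight (map ?h \<beta>) = psubst s (weight \<beta>)"
      by (simp add: psubst_weight) (simp add: weight_def comp_def)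
    show ?thesis
      unfolding flexion_def
      using at_word_in_ratfuns[OF B \<beta>] at_word_in_ratfuns[OF A \<alpha>]
        rsubst_at_word[OF B \<beta> s] rsubst_at_word[OF A \<alpha> s]
      by (simp add: ratfuns_mult rsubst_mult[OF s] shift_lsubst weight psubst_add)
  qed
  have concat: "at_word B \<beta> * at_word A \<alpha> \<in> ratfuns m \<and>
      rsubst s (at_word B \<beta> * at_word A \<alpha>) = at_word B (map ?h \<beta>) * at_word A (map ?h \<alpha>)"
    if "w = \<alpha> @ \<beta>" for \<alpha> \<beta>
  proof -
    have adm: "admissible \<alpha>" "admissible \<beta>" "word_in m \<alpha>" "word_in m \<beta>"
      using w admissible_append unfolding that by auto
    show ?thesis
      using at_word_in_ratfuns[OF B adm(2,4)] at_word_in_ratfuns[OF A adm(1,3)]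
        rsubst_at_word[OF B adm(2,4) s] rsubst_at_word[OF A adm(1,3) s]
      by (simp add: ratfuns_mult rsubst_mult[OF s])
  qed
  have 1: "deconc_sum w (\<lambda>\<alpha> v. deconc_sum v (\<lambda>\<beta> v'. uncons_term v' (\<lambda>x \<gamma>. ?f \<alpha> x \<beta> \<gamma>))) \<in> ratfuns m \<and>
      rsubst s (deconc_sum w (\<lambda>\<alpha> v. deconc_sum v (\<lambda>\<beta> v'. uncons_term v' (\<lambda>x \<gamma>. ?f \<alpha> x \<beta> \<gamma>)))) =
      deconc_sum w (\<lambda>\<alpha> v. deconc_sum v (\<lambda>\<beta> v'. uncons_term v' (\<lambda>x \<gamma>.
        ?f (map ?h \<alpha>) (?h x) (map ?h \<beta>) (map ?h \<gamma>))))"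
    by (intro deconc_sum_rsubst[OF s] uncons_term_rsubst flex) simp
  have 2: "deconc_sum w (\<lambda>\<alpha> v. uncons_term v (\<lambda>x v'. deconc_sum v' (\<lambda>\<beta> \<gamma>. ?f \<alpha> x \<beta> \<gamma>))) \<in> ratfuns m \<and>
      rsubst s (deconc_sum w (\<lambda>\<alpha> v. uncons_term v (\<lambda>x v'. deconc_sum v' (\<lambda>\<beta> \<gamma>. ?f \<alpha> x \<beta> \<gamma>)))) =
      deconc_sum w (\<lambda>\<alpha> v. uncons_term v (\<lambda>x v'. deconc_sum v' (\<lambda>\<beta> \<gamma>.
        ?f (map ?h \<alpha>) (?h x) (map ?h \<beta>) (map ?h \<gamma>))))"
    by (intro deconc_sum_rsubst[OF s] uncons_term_rsubst flex) simp
  have 3: "deconc_sum w (\<lambda>\<alpha> \<beta>. at_word B \<beta> * at_word A \<alpha>) \<in> ratfuns m \<and>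
      rsubst s (deconc_sum w (\<lambda>\<alpha> \<beta>. at_word B \<beta> * at_word A \<alpha>)) =
      deconc_sum w (\<lambda>\<alpha> \<beta>. at_word B (map ?h \<beta>) * at_word A (map ?h \<alpha>))"
    by (intro deconc_sum_rsubst[OF s] concat)
  show ?thesis
    unfolding preari_fun_def deconc_sum_map uncons_term_map
    using 1 2 3 by (simp add: rsubst_add[OF s] rsubst_diff[OF s] ratfuns_add ratfuns_diff)
qed

text \<open>Links the definition to the combinatorial operation, at the generic word. The assumption
  on B removes the terms with empty \<beta> that \<open>preari_fun\<close> includes and
  \<open>arit\<close> excludes.\<close>

lemma preari_eq_preari_fun:
  assumes "B [] = 0"
  shows "preari A B \<sigma>s = preari_fun (at_word B) (at_word A) (uword 0 \<sigma>s)"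
proof -
  let ?w = "uword 0 \<sigma>s"
  let ?f = "flexion (at_word B) (at_word A)"
  have B0: "at_word B [] = 0" by (simp add: at_word_def assms)
  have "deconc_sum ?w (\<lambda>\<alpha> v. deconc_sum v (\<lambda>\<beta> \<gamma>. if \<beta> \<noteq> [] \<and> \<gamma> \<noteq> []
        then at_word A (\<alpha> @ upl \<beta> \<gamma>) * at_word B (lowr \<beta> \<gamma>) else 0)) =
      deconc_sum ?w (\<lambda>\<alpha> v. deconc_sum v (\<lambda>\<beta> \<gamma>. if \<gamma> = [] then 0 else ?f \<alpha> (hd \<gamma>) \<beta> (tl \<gamma>)))"
    by (intro deconc_sum_cong)
      (auto simp: B0 flexion_def upl_def lowr_def shift_def weight_def add.commute)
  also have "\<dots> = deconc_sum ?w (\<lambda>\<alpha> v. deconc_sum v (\<lambda>\<beta> v'. uncons_term v' (\<lambda>x \<gamma>. ?f \<alpha> x \<beta> \<gamma>)))"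
    by (intro deconc_sum_cong) (simp add: uncons_term_def split: list.split)
  finally have 1: "(\<Sum>(\<alpha>, \<beta>, \<gamma>) \<in> {(\<alpha>, \<beta>, \<gamma>). ?w = \<alpha> @ \<beta> @ \<gamma> \<and> \<beta> \<noteq> [] \<and> \<gamma> \<noteq> []}.
          at_word A (\<alpha> @ upl \<beta> \<gamma>) * at_word B (lowr \<beta> \<gamma>)) =
      deconc_sum ?w (\<lambda>\<alpha> v. deconc_sum v (\<lambda>\<beta> v'. uncons_term v' (\<lambda>x \<gamma>. ?f \<alpha> x \<beta> \<gamma>)))"
    by (subst deconc_sum_set3)
  have "deconc_sum ?w (\<lambda>\<alpha> v. deconc_sum v (\<lambda>\<beta> \<gamma>. if \<alpha> \<noteq> [] \<and> \<beta> \<noteq> []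
        then at_word A (upr \<alpha> \<beta> @ \<gamma>) * at_word B (lowl \<alpha> \<beta>) else 0)) =
      deconc_sum ?w (\<lambda>\<alpha> v. if \<alpha> = [] then 0 else deconc_sum v (\<lambda>\<beta> \<gamma>. ?f (butlast \<alpha>) (last \<alpha>) \<beta> \<gamma>))"
    by (intro deconc_sum_cong)
      (auto simp: flexion_def upr_def lowl_def shift_def weight_def B0 intro!: deconc_sum_cong)
  also have "\<dots> = deconc_sum ?w (\<lambda>\<alpha> v. uncons_term v (\<lambda>x v'. deconc_sum v' (\<lambda>\<beta> \<gamma>. ?f \<alpha> x \<beta> \<gamma>)))"
    by (rule deconc_sum_unsnoc[of ?w "\<lambda>\<alpha> x v. deconc_sum v (?f \<alpha> x)"])
  finally have 2: "(\<Sum>(\<alpha>, \<beta>, \<gamma>) \<in> {(\<alpha>, \<beta>, \<gamma>). ?w = \<alpha> @ \<beta> @ \<gamma> \<and> \<alpha> \<noteq> [] \<and> \<beta> \<noteq> []}.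
          at_word A (upr \<alpha> \<beta> @ \<gamma>) * at_word B (lowl \<alpha> \<beta>)) =
      deconc_sum ?w (\<lambda>\<alpha> v. uncons_term v (\<lambda>x v'. deconc_sum v' (\<lambda>\<beta> \<gamma>. ?f \<alpha> x \<beta> \<gamma>)))"
    by (subst deconc_sum_set3)
  \<comment> \<open>In depth at most 1 \<open>arit\<close> is 0 by decree; the triple sums are empty
    there, so the general formula also holds.\<close>
  have "{(\<alpha>, \<beta>, \<gamma>). ?w = \<alpha> @ \<beta> @ \<gamma> \<and> \<beta> \<noteq> [] \<and> \<gamma> \<noteq> []} = {}"
      "{(\<alpha>, \<beta>, \<gamma>). ?w = \<alpha> @ \<beta> @ \<gamma> \<and> \<alpha> \<noteq> [] \<and> \<beta> \<noteq> []} = {}" if "length \<sigma>s \<le> 1"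
  proof -
    have "length (\<alpha> @ \<beta>) \<le> 1" if "?w = \<alpha> @ \<beta>" for \<alpha> \<beta>
      using \<open>length \<sigma>s \<le> 1\<close> unfolding that[symmetric] by simp
    then show "{(\<alpha>, \<beta>, \<gamma>). ?w = \<alpha> @ \<beta> @ \<gamma> \<and> \<beta> \<noteq> [] \<and> \<gamma> \<noteq> []} = {}"
      "{(\<alpha>, \<beta>, \<gamma>). ?w = \<alpha> @ \<beta> @ \<gamma> \<and> \<alpha> \<noteq> [] \<and> \<beta> \<noteq> []} = {}"
      by (fastforce simp: neq_Nil_conv)+
  qed
  then have "arit B A \<sigma>s =
      deconc_sum ?w (\<lambda>\<alpha> v. deconc_sum v (\<lambda>\<beta> v'. uncons_term v' (\<lambda>x \<gamma>. ?f \<alpha> x \<beta> \<gamma>))) -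
      deconc_sum ?w (\<lambda>\<alpha> v. uncons_term v (\<lambda>x v'. deconc_sum v' (\<lambda>\<beta> \<gamma>. ?f \<alpha> x \<beta> \<gamma>)))"
    unfolding arit_def 1[symmetric] 2[symmetric] by (cases "length \<sigma>s \<le> 1") (simp_all only: if_True if_False sum.empty diff_self)
  moreover have "mould_mult A B \<sigma>s = deconc_sum ?w (\<lambda>\<alpha> \<beta>. at_word B \<beta> * at_word A \<alpha>)"
    unfolding mould_mult_def deconc_sum_set by (simp only: mult.commute)
  ultimately show ?thesis by (simp add: preari_def preari_fun_def)
qed

lemma alg_indep_pvar: "alg_indep m pvar"
  by (simp add: alg_indep_def)

lemma preari_BIMU:
  assumes "A \<in> BIMU" "B \<in> ARI"
  shows "preari A B \<in> BIMU"
proof -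
  have B: "B \<in> BIMU" "B [] = 0" using assms(2) by (auto simp: ARI_def)
  show ?thesis
    unfolding BIMU_def
    using preari_fun_rsubst[OF assms(1) B(1) admissible_uword word_in_uword alg_indep_pvar]
    by (simp add: preari_eq_preari_fun[where B = B, OF B(2)])
qed

text \<open>The formula at the generic word, specialised along \<open>entries w\<close>. It is what
  allows iteration, since the next step needs the result at flexed words.\<close>

lemma at_word_preari:
  assumes A: "A \<in> BIMU" and "B \<in> ARI" and w: "admissible w"
  shows "at_word (preari A B) w = preari_fun (at_word B) (at_word A) w"
proof -
  have B: "B \<in> BIMU" "B [] = 0" using assms(2) by (auto simp: ARI_def)
  have "word_in (length w) (uword 0 (map snd w))" by (rule word_in_uword) simp
  then show ?thesis
    unfolding at_word_entries[of "preari A B"] preari_eq_preari_fun[where B = B, OF B(2)]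
    using preari_fun_rsubst[OF A B(1) admissible_uword _ admissible_alg_indep[OF w]]
    by (simp add: lsubst_uword)
qed

section \<open>Evaluation of \<open>expari\<close>\<close>

text \<open>Outside the admissible words, substitution may meet a zero denominator; setting the values
  there to zero makes alternality hold for all pairs of words.\<close>

definition eval_word :: "'g mould \<Rightarrow> (mpoly, 'g, ratfun) word_fun" where
  "eval_word M w = (if admissible w then at_word M w else 0)"

text \<open>Factors, shifts and flexions of an admissible word are admissible, so the operation
  never sees the default value of \<open>eval_word\<close>.\<close>

lemma preari_fun_cong_admissible:
  assumes "\<And>v. admissible v \<Longrightarrow> F v = F' v" "\<And>v. admissible v \<Longrightarrow> A v = A' v" "admissible w"
  shows "preari_fun F A w = preari_fun F' A' w"
proof -
  have flex: "flexion F A \<alpha> x \<beta> \<gamma> = flexion F' A' \<alpha> x \<beta> \<gamma>"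
    if "mset w = mset (\<alpha> @ \<beta> @ x # \<gamma>)" for \<alpha> x \<beta> \<gamma>
  proof -
    have adm: "admissible (\<alpha> @ \<beta> @ x # \<gamma>)" using assms(3) admissible_mset[OF that] by simp
    then have "admissible (shift (snd x) \<beta>)" by (auto dest!: admissible_append)
    then show ?thesis
      unfolding flexion_def using admissible_flexion[OF adm] by (simp add: assms)
  qed
  show ?thesis
    unfolding preari_fun_def
  proof (intro arg_cong2[of _ _ _ _ "(+)"] arg_cong2[of _ _ _ _ "(-)"] deconc_sum_cong)
    fix \<alpha> v \<beta> v' assume "w = \<alpha> @ v" "v = \<beta> @ v'"
    then show "uncons_term v' (\<lambda>x \<gamma>. flexion F A \<alpha> x \<beta> \<gamma>) = uncons_term v' (\<lambda>x \<gamma>. flexion F' A' \<alpha> x \<beta> \<gamma>)"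
      by (cases v') (simp_all add: flex)
  next
    fix \<alpha> v assume "w = \<alpha> @ v"
    then show "uncons_term v (\<lambda>x v'. deconc_sum v' (\<lambda>\<beta> \<gamma>. flexion F A \<alpha> x \<beta> \<gamma>)) =
        uncons_term v (\<lambda>x v'. deconc_sum v' (\<lambda>\<beta> \<gamma>. flexion F' A' \<alpha> x \<beta> \<gamma>))"
      by (cases v) (auto intro!: deconc_sum_cong flex)
  next
    fix \<alpha> \<beta> assume "w = \<alpha> @ \<beta>"
    then have "admissible \<alpha>" "admissible \<beta>" using assms(3) admissible_append by auto
    then show "F \<beta> * A \<alpha> = F' \<beta> * A' \<alpha>" by (simp add: assms)
  qed
qed

lemma mould_one_BIMU: "mould_one \<in> BIMU"
  by (simp add: BIMU_def mould_one_def)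

lemma preari_pow_BIMU: "M \<in> ARI \<Longrightarrow> preari_pow k M \<in> BIMU"
  by (induction k) (simp_all add: mould_one_BIMU preari_BIMU)

lemma at_word_preari_pow:
  assumes M: "M \<in> ARI"
  shows "admissible w \<Longrightarrow> at_word (preari_pow k M) w = preari_fun_pow k (eval_word M) w"
proof (induction k arbitrary: w)
  case 0
  then show ?case by (simp add: at_word_def mould_one_def)
next
  case (Suc k)
  have "at_word (preari_pow (Suc k) M) w = preari_fun (at_word M) (at_word (preari_pow k M)) w"
    using Suc.prems by (simp add: at_word_preari preari_pow_BIMU M)
  also have "\<dots> = preari_fun (eval_word M) (preari_fun_pow k (eval_word M)) w"
  proof (rule preari_fun_cong_admissible)
    show "at_word M v = eval_word M v" if "admissible v" for v
      using that by (simp add: eval_word_def)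
  qed (use Suc in simp_all)
  finally show ?case by simp
qed

lemma eval_word_Nil: "M \<in> ARI \<Longrightarrow> eval_word M [] = 0"
  by (simp add: eval_word_def at_word_def ARI_def)

lemma expari_sum:
  assumes M: "M \<in> ARI"
  shows "expari M \<sigma>s = (\<Sum>k\<le>length \<sigma>s. preari_pow k M \<sigma>s / of_nat (fact k))"
proof -
  have "preari_pow k M \<sigma>s = 0" if "length \<sigma>s < k" for k
    using at_word_preari_pow[OF M admissible_uword, of k 0 \<sigma>s] that
    by (simp add: at_word_uword preari_pow_BIMU M preari_fun_pow_eq_0 eval_word_Nil)
  then have "{k. preari_pow k M \<sigma>s / of_nat (fact k) \<noteq> 0} \<subseteq> {..length \<sigma>s}"
    by (force simp: not_less[symmetric])
  then show ?thesis
    unfolding expari_def by (intro Sum_any.expand_superset) auto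
qed

lemma expari_BIMU:
  assumes "M \<in> ARI"
  shows "expari M \<in> BIMU"
  using preari_pow_BIMU[OF assms]
  by (auto simp: BIMU_def expari_sum[OF assms] simp del: of_nat_fact intro!: ratfuns_sum ratfuns_divide_of_nat)

lemma rsubst_of_nat: "rsubst s (of_nat n) = of_nat n"
  by (simp add: of_nat_fract of_nat_mpoly rsubst_Fract)

lemma ratfuns_of_nat: "of_nat n \<in> ratfuns m"
  by (induction n) (simp_all add: ratfuns_add)

lemma rsubst_divide_of_nat:
  assumes s: "alg_indep m s" and f: "f \<in> ratfuns m" and n: "n \<noteq> 0"
  shows "rsubst s (f / of_nat n) = rsubst s f / of_nat n"
proof -
  have "rsubst s f = rsubst s (f / of_nat n * of_nat n)" using n by simp
  also have "\<dots> = rsubst s (f / of_nat n) * of_nat n"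
    by (subst rsubst_mult[OF s ratfuns_divide_of_nat[OF f n] ratfuns_of_nat]) (simp add: rsubst_of_nat)
  finally show ?thesis using n by simp
qed

lemma at_word_expari:
  assumes M: "M \<in> ARI" and w: "admissible w"
  shows "at_word (expari M) w = expari_fun (eval_word M) w"
proof -
  let ?s = "entries w"
  note s = admissible_alg_indep[OF w]
  have in_rat: "preari_pow k M (map snd w) \<in> ratfuns (length w)" for k
    using preari_pow_BIMU[OF M, of k] by (metis (mono_tags) BIMU_def length_map mem_Collect_eq)
  have "at_word (expari M) w = (\<Sum>k\<le>length w. rsubst ?s (preari_pow k M (map snd w) / of_nat (fact k)))"
    unfolding at_word_entries expari_sum[OF M] length_map
    by (rule rsubst_sum[OF s]) (intro ratfuns_divide_of_nat in_rat fact_nonzero)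
  also have "\<dots> = (\<Sum>k\<le>length w. at_word (preari_pow k M) w / of_nat (fact k))"
    unfolding at_word_entries by (intro sum.cong refl rsubst_divide_of_nat[OF s] in_rat fact_nonzero)
  also have "\<dots> = expari_fun (eval_word M) w"
    by (simp add: expari_fun_def at_word_preari_pow M w)
  finally show ?thesis .
qed

lemma expari_eq_expari_fun:
  assumes "M \<in> ARI"
  shows "expari M \<sigma>s = expari_fun (eval_word M) (uword 0 \<sigma>s)"
  using at_word_expari[OF assms admissible_uword] at_word_uword[OF expari_BIMU[OF assms]] by metis

text \<open>Reconciles the multiplicities \<open>Sh\<close> with summation over the multiset of
  shuffles.\<close>

lemma sum_mset_count:
  "(\<Sum>x\<in>#X. f x) = (\<Sum>x\<in>set_mset X. of_nat (count X x) * (f x :: 'k :: comm_semiring_1))"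
proof (induction X)
  case (add a X)
  have "(\<Sum>x\<in>set_mset (add_mset a X). of_nat (count (add_mset a X) x) * f x) =
      (\<Sum>x\<in>insert a (set_mset X). (if x = a then f a else 0) + of_nat (count X x) * f x)"
    by (rule sum.cong) (auto simp: distrib_right)
  also have "\<dots> = f a + (\<Sum>x\<in>insert a (set_mset X). of_nat (count X x) * f x)"
    by (simp add: sum.distrib)
  also have "(\<Sum>x\<in>insert a (set_mset X). of_nat (count X x) * f x) = (\<Sum>x\<in>set_mset X. of_nat (count X x) * f x)"
    by (rule sum.mono_neutral_right) (auto simp: not_in_iff)
  finally show ?case using add by simp
qed simp

lemma shuffle_sum_eq_shuf_sum: "shuffle_sum M \<omega> \<eta> = shuf_sum \<omega> \<eta> (at_word M)"
  unfolding shuffle_sum_def shuf_sum_def Sh_def by (rule sum_mset_count[symmetric])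

lemma shuf_sum_rsubst:
  assumes s: "alg_indep m s" and "\<And>w. mset w = mset (\<omega> @ \<eta>) \<Longrightarrow> f w \<in> ratfuns m"
  shows "rsubst s (shuf_sum \<omega> \<eta> f) = shuf_sum \<omega> \<eta> (\<lambda>w. rsubst s (f w))"
proof -
  have "rsubst s (\<Sum>x\<in>#X. f x) = (\<Sum>x\<in>#X. rsubst s (f x)) \<and> (\<Sum>x\<in>#X. f x) \<in> ratfuns m"
    if "\<And>x. x \<in># X \<Longrightarrow> f x \<in> ratfuns m" for X
    using that by (induction X) (simp_all add: rsubst_add[OF s] ratfuns_add)
  then show ?thesis unfolding shuf_sum_def using assms(2) mset_shuffle by metis
qed

text \<open>Alternality is assumed at generic words only. An admissible pair is a specialisation of
  the generic pair; for any other pair no shuffle is admissible, and all terms are 0.\<close>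

lemma alternal_eval_word:
  assumes "M \<in> ARI_al"
  shows "alternal_fun (eval_word M)"
  unfolding alternal_fun_def
proof (intro conjI allI impI)
  have M: "M \<in> ARI" using assms by (simp add: ARI_al_def)
  then have BIMU: "M \<in> BIMU" by (simp add: ARI_def)
  show "eval_word M [] = 0" by (rule eval_word_Nil[OF M])
  fix \<omega> \<eta> :: "'a word" assume ne: "\<omega> \<noteq> []" "\<eta> \<noteq> []"
  show "shuf_sum \<omega> \<eta> (eval_word M) = 0"
  proof (cases "admissible (\<omega> @ \<eta>)")
    case False
    have "\<not> admissible w" if "mset w = mset (\<omega> @ \<eta>)" for w
      using False admissible_mset[OF that] by simp
    then have "shuf_sum \<omega> \<eta> (eval_word M) = shuf_sum \<omega> \<eta> (\<lambda>_. 0)"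
      by (intro shuf_sum_cong) (simp add: eval_word_def)
    then show ?thesis by simp
  next
    case True
    define u where "u = uword 0 (map snd \<omega>)"
    define v where "v = uword (length \<omega>) (map snd \<eta>)"
    \<comment> \<open>A single substitution for both words: a shuffle mixes their letters, so the
      entries must be independent jointly.\<close>
    define s where "s = entries (\<omega> @ \<eta>)"
    have uv: "uword 0 (map snd (\<omega> @ \<eta>)) = u @ v"
      by (simp add: u_def v_def uword_append)
    have "map (lsubst s) (u @ v) = \<omega> @ \<eta>"
      unfolding s_def uv[symmetric] by (rule lsubst_uword)
    then have wv: "map (lsubst s) u = \<omega>" "map (lsubst s) v = \<eta>"
      by (simp_all add: u_def v_def append_eq_append_conv)
    have s: "alg_indep (length (\<omega> @ \<eta>)) s"
      unfolding s_def by (rule admissible_alg_indep[OF True])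
    have adm: "admissible w" "word_in (length (\<omega> @ \<eta>)) w" if "mset w = mset (u @ v)" for w
      using admissible_mset[OF that] word_in_mset[OF that] unfolding uv[symmetric]
      by (simp_all add: word_in_uword)
    have "admissible w" if "mset w = mset (\<omega> @ \<eta>)" for w
      using True admissible_mset[OF that] by simp
    then have "shuf_sum \<omega> \<eta> (eval_word M) = shuf_sum \<omega> \<eta> (at_word M)"
      by (intro shuf_sum_cong) (simp add: eval_word_def)
    also have "\<dots> = shuf_sum u v (\<lambda>w. at_word M (map (lsubst s) w))"
      unfolding shuf_sum_map[symmetric] wv ..
    also have "\<dots> = shuf_sum u v (\<lambda>w. rsubst s (at_word M w))"
      by (rule shuf_sum_cong) (rule rsubst_at_word[symmetric, OF BIMU adm s])
    also have "\<dots> = rsubst s (shuf_sum u v (at_word M))"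
      by (rule shuf_sum_rsubst[symmetric, OF s]) (rule at_word_in_ratfuns[OF BIMU adm])
    also have "shuf_sum u v (at_word M) = 0"
    proof -
      have "shuffle_sum M (uword 0 (map snd \<omega>)) (uword (length (map snd \<omega>)) (map snd \<eta>)) = 0"
        using assms ne unfolding ARI_al_def by blast
      then show ?thesis by (simp add: shuffle_sum_eq_shuf_sum u_def v_def)
    qed
    finally show ?thesis by simp
  qed
qed

lemma expari_ARI_al:
  assumes "M \<in> ARI_al"
  shows "expari M \<in> GARI_as"
proof -
  have M: "M \<in> ARI" using assms by (simp add: ARI_al_def)
  have "expari M [] = 1"
    by (simp add: expari_eq_expari_fun[OF M] expari_fun_def uword_def)
  moreover have "shuffle_sum (expari M) (uword 0 \<sigma>s) (uword (length \<sigma>s) \<tau>s) =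
       at_word (expari M) (uword 0 \<sigma>s) * at_word (expari M) (uword (length \<sigma>s) \<tau>s)" for \<sigma>s \<tau>s
  proof -
    let ?u = "uword 0 \<sigma>s" and ?v = "uword (length \<sigma>s) \<tau>s"
    have "admissible w" if "mset w = mset (?u @ ?v)" for w
      using admissible_mset[OF that] by simp
    then have "shuf_sum ?u ?v (at_word (expari M)) = shuf_sum ?u ?v (expari_fun (eval_word M))"
      by (intro shuf_sum_cong) (simp add: at_word_expari[OF M])
    then show ?thesis
      by (simp add: shuffle_sum_eq_shuf_sum expari_fun_symmetral alternal_eval_word assms at_word_expari[OF M])
  qed
  ultimately show ?thesis
    by (simp add: GARI_as_def GARI_def expari_BIMU[OF M])
qed

section \<open>Surjectivity\<close>

text \<open>Stage r vanishes above depth r. The component added in depth \<open>Suc r\<close> is the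
  defect left by the previous stage, because a new component of top depth enters the exponential
  additively with coefficient 1.\<close>

primrec log_approx :: "('g :: ab_group_add) mould \<Rightarrow> nat \<Rightarrow> 'g mould" where
  "log_approx S 0 = (\<lambda>_. 0)"
| "log_approx S (Suc r) = (\<lambda>\<sigma>s. if length \<sigma>s = Suc r then S \<sigma>s - expari (log_approx S r) \<sigma>s
     else log_approx S r \<sigma>s)"

lemma at_word_cong: "M (map snd w) = N (map snd w) \<Longrightarrow> at_word M w = at_word N w"
  by (simp add: at_word_def)

lemma eval_word_cong: "M (map snd w) = N (map snd w) \<Longrightarrow> eval_word M w = eval_word N w"
  by (simp add: eval_word_def at_word_def)

lemma shuf_sum_uword_cong:
  assumes "\<And>w. admissible w \<Longrightarrow> length w = length \<sigma>s + length \<tau>s \<Longrightarrow> f w = g w"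
  shows "shuf_sum (uword 0 \<sigma>s) (uword (length \<sigma>s) \<tau>s) f = shuf_sum (uword 0 \<sigma>s) (uword (length \<sigma>s) \<tau>s) g"
proof (rule shuf_sum_cong)
  fix w assume *: "mset w = mset (uword 0 \<sigma>s @ uword (length \<sigma>s) \<tau>s)"
  show "f w = g w"
    by (rule assms) (use admissible_mset[OF *] mset_eq_length[OF *] in simp_all)
qed

lemma log_approx_eq_0: "length \<sigma>s > r \<Longrightarrow> log_approx S r \<sigma>s = 0"
  by (induction r) (auto split: if_splits)

lemma at_word_diff:
  assumes "admissible w" "A \<in> BIMU" "B \<in> BIMU"
  shows "at_word (\<lambda>\<sigma>s. A \<sigma>s - B \<sigma>s) w = at_word A w - at_word B w"
proof -
  have "A (map snd w) \<in> ratfuns (length w)" "B (map snd w) \<in> ratfuns (length w)"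
    using assms(2,3) by (metis (mono_tags) BIMU_def length_map mem_Collect_eq)+
  then show ?thesis
    unfolding at_word_entries by (rule rsubst_diff[OF admissible_alg_indep[OF assms(1)]])
qed

lemma log_approx_correct:
  assumes S: "S \<in> GARI_as"
  shows "log_approx S r \<in> ARI_al \<and> (\<forall>\<sigma>s. length \<sigma>s \<le> r \<longrightarrow> expari (log_approx S r) \<sigma>s = S \<sigma>s)"
proof (induction r)
  case 0
  have "at_word (\<lambda>_. 0) = (\<lambda>w :: 'a word. 0)" by (simp add: at_word_def fun_eq_iff)
  then have al: "(\<lambda>_. 0 :: ratfun) \<in> (ARI_al :: 'a mould set)"
    by (simp add: ARI_al_def ARI_def BIMU_def shuffle_sum_eq_shuf_sum)
  moreover have "expari (\<lambda>_ :: 'a list. 0) [] = 1"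
    using expari_ARI_al[OF al] by (simp add: GARI_as_def GARI_def)
  ultimately show ?case using S by (simp add: GARI_as_def GARI_def)
next
  case (Suc r)
  let ?N = "log_approx S r" and ?N' = "log_approx S (Suc r)"
  have al: "?N \<in> ARI_al" and exp: "\<And>\<sigma>s. length \<sigma>s \<le> r \<Longrightarrow> expari ?N \<sigma>s = S \<sigma>s"
    using Suc by auto
  have N: "?N \<in> ARI" using al by (simp add: ARI_al_def)
  have SB: "S \<in> BIMU" using S by (simp add: GARI_as_def GARI_def)
  have EB: "expari ?N \<in> BIMU" by (rule expari_BIMU[OF N])
  have N': "?N' \<in> ARI"
    using N SB EB by (auto simp: ARI_def BIMU_def) (metis ratfuns_diff)
  have "shuffle_sum ?N' (uword 0 \<sigma>s) (uword (length \<sigma>s) \<tau>s) = 0" if ne: "\<sigma>s \<noteq> []" "\<tau>s \<noteq> []" for \<sigma>s \<tau>s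
  proof (cases "length \<sigma>s + length \<tau>s = Suc r")
    case True
    let ?u = "uword 0 \<sigma>s" and ?v = "uword (length \<sigma>s) \<tau>s"
    have "shuf_sum ?u ?v (at_word ?N') = shuf_sum ?u ?v (\<lambda>w. at_word S w - at_word (expari ?N) w)"
    proof (rule shuf_sum_uword_cong)
      fix w :: "'a word" assume w: "admissible w" "length w = length \<sigma>s + length \<tau>s"
      have "at_word ?N' w = at_word (\<lambda>\<sigma>s. S \<sigma>s - expari ?N \<sigma>s) w"
        by (rule at_word_cong) (simp add: w True)
      then show "at_word ?N' w = at_word S w - at_word (expari ?N) w"
        by (simp add: at_word_diff[OF w(1) SB EB])
    qed
    \<comment> \<open>Symmetrality of S and of the exponential of the previous stage; both factors
      have depth at most r, where the two moulds agree, so the products cancel.\<close>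
    also have "\<dots> = at_word S ?u * at_word S ?v - at_word (expari ?N) ?u * at_word (expari ?N) ?v"
      using S expari_ARI_al[OF al] ne
      by (simp add: shuf_sum_diff GARI_as_def flip: shuffle_sum_eq_shuf_sum)
    also have "\<dots> = 0"
    proof -
      have "length \<sigma>s \<le> r" "length \<tau>s \<le> r" using True ne by (cases \<sigma>s; cases \<tau>s; simp)+
      then have "at_word (expari ?N) ?u = at_word S ?u" "at_word (expari ?N) ?v = at_word S ?v"
        by (auto intro!: at_word_cong simp: exp)
      then show ?thesis by simp
    qed
    finally show ?thesis by (simp only: shuffle_sum_eq_shuf_sum)
  next
    case False
    have "shuffle_sum ?N' (uword 0 \<sigma>s) (uword (length \<sigma>s) \<tau>s) =
        shuffle_sum ?N (uword 0 \<sigma>s) (uword (length \<sigma>s) \<tau>s)"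
      unfolding shuffle_sum_eq_shuf_sum
      by (intro shuf_sum_uword_cong at_word_cong) (simp add: False)
    then show ?thesis using al ne by (simp add: ARI_al_def)
  qed
  then have al': "?N' \<in> ARI_al" using N' by (simp add: ARI_al_def)
  moreover have "expari ?N' \<sigma>s = S \<sigma>s" if len: "length \<sigma>s \<le> Suc r" for \<sigma>s
  proof (cases "length \<sigma>s = Suc r")
    case True
    \<comment> \<open>The stages \<open>?N\<close> and \<open>?N'\<close> agree below depth
      \<open>Suc r\<close>, and \<open>?N\<close> vanishes in that depth; the difference of the
      exponentials is therefore exactly the defect.\<close>
    have "expari ?N' \<sigma>s - expari ?N \<sigma>s = eval_word ?N' (uword 0 \<sigma>s) - eval_word ?N (uword 0 \<sigma>s)"
      unfolding expari_eq_expari_fun[OF N] expari_eq_expari_fun[OF N']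
      by (intro expari_fun_diff eval_word_cong eval_word_Nil N N') (use True in auto)
    also have "\<dots> = ?N' \<sigma>s - ?N \<sigma>s"
      using N N' unfolding eval_word_def by (simp add: at_word_uword ARI_def del: log_approx.simps)
    also have "\<dots> = S \<sigma>s - expari ?N \<sigma>s" by (simp add: True log_approx_eq_0)
    finally show ?thesis by simp
  next
    case False
    have "expari ?N' \<sigma>s = expari ?N \<sigma>s"
      unfolding expari_eq_expari_fun[OF N] expari_eq_expari_fun[OF N']
      by (intro expari_fun_cong eval_word_cong) (use False len in auto)
    then show ?thesis using False len exp by simp
  qed
  ultimately show ?case by blast
qed

lemma log_approx_stable: "length \<sigma>s \<le> r \<Longrightarrow> log_approx S r \<sigma>s = log_approx S (length \<sigma>s) \<sigma>s"
  by (induction r) (auto simp: le_Suc_eq)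

theorem theoremA7:
  shows "expari ` (ARI_al :: ('g :: {finite, ab_group_add}) mould set) = GARI_as"
proof (intro equalityI subsetI)
  fix S :: "'g mould" assume "S \<in> expari ` ARI_al"
  then show "S \<in> GARI_as" using expari_ARI_al by blast
next
  fix S :: "'g mould" assume S: "S \<in> GARI_as"
  \<comment> \<open>The stages stabilise in each depth, so this diagonal is their limit. Every later
    claim on M involves boundedly many depths and can be checked on a single stage.\<close>
  define M where "M \<sigma>s = log_approx S (length \<sigma>s) \<sigma>s" for \<sigma>s
  have M_eq: "M \<sigma>s = log_approx S r \<sigma>s" if "length \<sigma>s \<le> r" for \<sigma>s r
    using log_approx_stable[OF that] by (simp add: M_def)
  have al: "log_approx S r \<in> ARI_al" for r using log_approx_correct[OF S] by blast
  then have ari: "log_approx S r \<in> ARI" for r by (simp add: ARI_al_def)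
  have M: "M \<in> ARI"
    using ari by (auto simp: ARI_def BIMU_def M_def)
  have "shuffle_sum M (uword 0 \<sigma>s) (uword (length \<sigma>s) \<tau>s) = 0" if "\<sigma>s \<noteq> []" "\<tau>s \<noteq> []" for \<sigma>s \<tau>s
  proof -
    have "shuffle_sum M (uword 0 \<sigma>s) (uword (length \<sigma>s) \<tau>s) =
        shuffle_sum (log_approx S (length \<sigma>s + length \<tau>s)) (uword 0 \<sigma>s) (uword (length \<sigma>s) \<tau>s)"
      unfolding shuffle_sum_eq_shuf_sum
      by (intro shuf_sum_uword_cong at_word_cong M_eq) simp
    then show ?thesis using al that by (simp add: ARI_al_def)
  qed
  then have "M \<in> ARI_al" using M by (simp add: ARI_al_def)
  moreover have "expari M = S"
  proof
    fix \<sigma>s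
    have "expari M \<sigma>s = expari (log_approx S (length \<sigma>s)) \<sigma>s"
      unfolding expari_eq_expari_fun[OF M] expari_eq_expari_fun[OF ari]
      by (intro expari_fun_cong eval_word_cong M_eq) simp
    then show "expari M \<sigma>s = S \<sigma>s" using log_approx_correct[OF S] by simp
  qed
  ultimately show "S \<in> expari ` ARI_al" by blast
qed

end
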